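(* Let $(\mu,\nu)\in\boldsymbol{\mathcal P}$ and let $\varphi\in C([0,1],\mathcal P([0,1]))$ be monotonic, i.e. $\varphi(s)\le_{st}\varphi(t)$ whenever $0\le s\le t\le1$. Let $G^\varphi_{(\mu,\nu)}$ be the unique continuous map $G:\mathbb S\to\mathcal P([0,1])$ satisfying, for all $(x,y)\in\mathbb S$, $$x\int_0^\beta \big(G(x,y)-G(x+k,y)\big)\mu(dk)+y\int_0^\beta\big(G(x,y)-G(x,y+k)\big)\nu(dk)=0,$$ $G(0,y)=\varphi(0)$, $G(x,0)=\varphi(1)$, and $d_W\big(G(x,y),\varphi(\tfrac{x}{x+y})\big)\to0$ as $x+y\to\infty$. Let $\Phi=\int_0^1\varphi(t)\,dt$, i.e. $\Phi(B)=\int_0^1\varphi(t)(B)\,dt$ for Borel $B\subseteq[0,1]$. Then: (1) if there is $(x_0,y_0)$ with $x_0>0,y_0>0$ such that $G^\varphi_{(\mu,\nu)}(x_0,y_0)$ has no point masses in $[0,1]$, then $\Phi$ has no point masses in $[0,1]$; (2) if $\Phi$ has no point masses in $[0,1]$, then $G^\varphi_{(\mu,\nu)}(x,y)$ has no point masses in $[0,1]$ for all $x>0,y>0$.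
   Context: $\mathcal P([0,\beta])$: Borel probability measures on $[0,\beta]$ with 1-Wasserstein metric $d_W$. Fix $0<m_0\le\beta<\infty$. $\boldsymbol{\mathcal P}$: pairs $(\mu,\nu)$ of probability measures on $[0,\beta]$ with equal means $\int k\,\mu(dk)=\int k\,\nu(dk)\ge m_0$. $\mathbb S=[0,\infty)^2\setminus\{(0,0)\}$. $\varphi:[0,1]\to(\mathcal P([0,1]),d_W)$ continuous (a boundary datum); existence and uniqueness of $G^\varphi_{(\mu,\nu)}$ is part of the setting. $\le_{st}$ is the usual stochastic order: $\xi_1\le_{st}\xi_2$ iff $F_{\xi_1}(z)\ge F_{\xi_2}(z)$ for all $z$. The functional equation is an identity of signed measures. *)

theory Defs
  imports "HOL-Probability.Probability"
begin

text \<open>Borel probability measures on the real line concentrated on [a,b];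
  this represents P([a,b]).\<close>
definition prob_on :: "real \<Rightarrow> real \<Rightarrow> real measure \<Rightarrow> bool" where
  "prob_on a b M \<longleftrightarrow> prob_space M \<and> sets M = sets borel \<and> measure M {a..b} = 1"

definition coupling :: "real measure \<Rightarrow> real measure \<Rightarrow> (real \<times> real) measure \<Rightarrow> bool" where
  "coupling M N \<pi> \<longleftrightarrow> prob_space \<pi> \<and> sets \<pi> = sets (borel \<Otimes>\<^sub>M borel)
     \<and> distr \<pi> borel fst = M \<and> distr \<pi> borel snd = N"

definition wasserstein1 :: "real measure \<Rightarrow> real measure \<Rightarrow> real" where
  "wasserstein1 M N = Inf {(\<integral>p. \<bar>fst p - snd p\<bar> \<partial>\<pi>) | \<pi>. coupling M N \<pi>}"

definition SS :: "(real \<times> real) set" where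
  "SS = {p. fst p \<ge> 0 \<and> snd p \<ge> 0 \<and> p \<noteq> (0,0)}"

definition st_le :: "real measure \<Rightarrow> real measure \<Rightarrow> bool" where
  "st_le M N \<longleftrightarrow> (\<forall>z. measure M {..z} \<ge> measure N {..z})"

definition W_continuous_on :: "('a::metric_space) set \<Rightarrow> ('a \<Rightarrow> real measure) \<Rightarrow> bool" where
  "W_continuous_on A f \<longleftrightarrow> (\<forall>p\<in>A. \<forall>e>0. \<exists>d>0. \<forall>q\<in>A. dist q p < d \<longrightarrow> wasserstein1 (f q) (f p) < e)"

definition Phi :: "(real \<Rightarrow> real measure) \<Rightarrow> real set \<Rightarrow> real" where
  "Phi \<phi> B = (LINT t:{0..1}|lborel. measure (\<phi> t) B)"

definition is_G :: "real \<Rightarrow> real measure \<Rightarrow> real measure \<Rightarrow> (real \<Rightarrow> real measure)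
    \<Rightarrow> (real \<times> real \<Rightarrow> real measure) \<Rightarrow> bool" where
  "is_G \<beta> \<mu> \<nu> \<phi> G \<longleftrightarrow>
     (\<forall>p\<in>SS. prob_on 0 1 (G p)) \<and> W_continuous_on SS G \<and>
     (\<forall>x y B. (x,y) \<in> SS \<longrightarrow> B \<in> sets borel \<longrightarrow>
        x * (LINT k:{0..\<beta>}|\<mu>. measure (G (x,y)) B - measure (G (x+k,y)) B)
      + y * (LINT k:{0..\<beta>}|\<nu>. measure (G (x,y)) B - measure (G (x,y+k)) B) = 0) \<and>
     (\<forall>y>0. G (0,y) = \<phi> 0) \<and> (\<forall>x>0. G (x,0) = \<phi> 1) \<and>
     (\<forall>e>0. \<exists>R. \<forall>x y. (x,y) \<in> SS \<longrightarrow> x + y > R \<longrightarrow> wasserstein1 (G (x,y)) (\<phi> (x/(x+y))) < e)"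

end

theory Submission
  imports Defs
begin

text \<open>For a Borel set \<open>B\<close> the function \<open>u(x, y) = G(x, y)(B)\<close> is harmonic for the urn that moves from
  \<open>(x, y)\<close> to \<open>(x + k, y)\<close> with probability \<open>x / (x + y)\<close>, \<open>k\<close> distributed as \<open>\<mu>\<close>, and to \<open>(x, y + k)\<close>
  otherwise, \<open>k\<close> distributed as \<open>\<nu>\<close>. Its proportion \<open>x / (x + y)\<close> converges to a limit whose law has no
  atoms and charges every subinterval of \<open>[0, 1]\<close>. Without constructing the urn process, this is
  expressed by explicit superharmonic functions and a minimum principle on \<open>(0, \<infinity>)\<^sup>2\<close>, where only the
  behaviour as \<open>x + y\<close> tends to infinity matters.

  By monotonicity of \<open>\<phi>\<close>, the set of \<open>t\<close> with \<open>\<phi>(t)({z}) > 0\<close> is countable if \<open>\<Phi>({z}) = 0\<close>, and otherwise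
  \<open>\<phi>(t)({z})\<close> is bounded below by a positive constant on an interval. In the first case the
  boundary values of \<open>u = G({z})\<close> are at most \<open>\<epsilon>\<close> off isolated rays; a second moment estimate shows that the
  \<open>limsup\<close> \<open>M\<close> of \<open>u\<close> along such a ray satisfies \<open>M \<le> (1 - \<kappa>) M\<close> up to \<open>\<epsilon>\<close>, with \<open>\<kappa> > 0\<close> independent of \<open>\<epsilon>\<close>,
  and the rays \<open>t = 0\<close> and \<open>t = 1\<close> are not seen thanks to a logarithmic superharmonic function. In the
  second case \<open>u\<close> is positive far out along a ray, and positivity propagates back to all states.\<close>

section \<open>Superharmonic functions of the urn\<close>

text \<open>\<open>P\<close> and \<open>Q\<close> are the laws of the steps in the two directions.
  They live on the subspace [0, \<beta>], so that integrands have to be measurable and bounded only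
  for admissible steps.\<close>

locale urn =
  fixes \<beta> m :: real and P Q :: "real measure"
  assumes prob: "prob_space P" "prob_space Q"
    and sets_eq: "sets P = sets (restrict_space borel {0..\<beta>})"
      "sets Q = sets (restrict_space borel {0..\<beta>})"
    and mean: "(\<integral>k. k \<partial>P) = m" "(\<integral>k. k \<partial>Q) = m"
    and m_pos: "0 < m"
begin

lemma space_eq: "space P = {0..\<beta>}" "space Q = {0..\<beta>}"
  using sets_eq[THEN sets_eq_imp_space_eq] by (simp_all add: space_restrict_space)

lemma integrable_bounded:
  assumes "N = P \<or> N = Q" "f \<in> borel_measurable (restrict_space borel {0..\<beta>})"
    and "\<And>k. 0 \<le> k \<Longrightarrow> k \<le> \<beta> \<Longrightarrow> \<bar>f k\<bar> \<le> C"
  shows "integrable N (f :: real \<Rightarrow> real)"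
proof -
  interpret prob_space N using assms(1) prob by auto
  have "sets N = sets (restrict_space borel {0..\<beta>})" "space N = {0..\<beta>}"
    using assms(1) sets_eq space_eq by auto
  then show ?thesis
    using assms(2,3)
    by (intro integrable_const_bound[where B = C]) (auto cong: measurable_cong_sets)
qed

lemma integrable_continuous:
  assumes "N = P \<or> N = Q" "continuous_on {0..\<beta>} f"
  shows "integrable N (f :: real \<Rightarrow> real)"
proof -
  have "bounded (f ` {0..\<beta>})"
    using assms(2) by (intro compact_imp_bounded compact_continuous_image) auto
  then obtain C where "\<forall>k\<in>{0..\<beta>}. \<bar>f k\<bar> \<le> C"
    by (auto simp: bounded_iff)
  then show ?thesis
    using assms by (intro integrable_bounded[where C = C] borel_measurable_continuous_on_restrict) auto
qed

lemma integral_affine: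
  assumes "N = P \<or> N = Q"
  shows "(\<integral>k. a * k + c \<partial>N) = a * m + c"
proof -
  interpret prob_space N using assms prob by auto
  have "integrable N (\<lambda>k. a * k)" 
    using assms by (intro integrable_continuous) (auto intro!: continuous_intros)
  then show ?thesis using assms mean by (auto simp: prob_space)
qed

text \<open>Only the mean of a step law and its bound \<beta> are known, so integrals over a step
  are estimated through affine majorants of the integrand.\<close>

lemma integral_le_affine:
  assumes "N = P \<or> N = Q" "integrable N f" "\<And>k. 0 \<le> k \<Longrightarrow> k \<le> \<beta> \<Longrightarrow> f k \<le> a * k + c"
  shows "(\<integral>k. f k \<partial>N) \<le> a * m + c"
proof -
  have "(\<integral>k. f k \<partial>N) \<le> (\<integral>k. a * k + c \<partial>N)"
  proof (rule integral_mono)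
    show "integrable N (\<lambda>k. a * k + c)"
      using assms(1) by (intro integrable_continuous continuous_intros)
  qed (use assms space_eq in auto)
  with integral_affine[OF assms(1)] show ?thesis by simp
qed

lemma m_le: "m \<le> \<beta>"
  using integral_le_affine[of P "\<lambda>k. k" 0 \<beta>] integrable_continuous[of P "\<lambda>k. k"] mean
  by auto

lemma \<beta>_pos: "0 < \<beta>"
  using m_pos m_le by simp

text \<open>The one-step inequality, multiplied by \<open>x + y\<close>. Integrability is included
  because a non-integrable function has integral 0 by convention. The threshold \<open>R\<close> is
  there because some of the functions below are superharmonic only for sums at least
  \<beta>.\<close>

definition superharmonic :: "real \<Rightarrow> (real \<Rightarrow> real \<Rightarrow> real) \<Rightarrow> bool" where
  "superharmonic R h \<longleftrightarrow> (\<forall>x>0. \<forall>y>0. R \<le> x + y \<longrightarrow>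
     integrable P (\<lambda>k. h (x + k) y) \<and> integrable Q (\<lambda>k. h x (y + k)) \<and>
     x * (\<integral>k. h (x + k) y \<partial>P) + y * (\<integral>k. h x (y + k) \<partial>Q) \<le> (x + y) * h x y)"

lemma superharmonic_antimono: "superharmonic R h \<Longrightarrow> R \<le> R' \<Longrightarrow> superharmonic R' h"
  unfolding superharmonic_def by (meson order_trans)

lemma superharmonic_add:
  assumes "superharmonic R f" "superharmonic R g"
  shows "superharmonic R (\<lambda>x y. f x y + g x y)"
  using assms unfolding superharmonic_def by (fastforce simp: distrib_left)

lemma superharmonic_cmult:
  assumes "superharmonic R f" "0 \<le> c"
  shows "superharmonic R (\<lambda>x y. c * f x y)"
  unfolding superharmonic_def
proof (intro allI impI conjI)
  fix x y :: real assume xy: "0 < x" "0 < y" "R \<le> x + y"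
  with assms(1) show "integrable P (\<lambda>k. c * f (x + k) y)" "integrable Q (\<lambda>k. c * f x (y + k))"
    unfolding superharmonic_def by auto
  have "x * (\<integral>k. f (x + k) y \<partial>P) + y * (\<integral>k. f x (y + k) \<partial>Q) \<le> (x + y) * f x y"
    using assms(1) xy unfolding superharmonic_def by blast
  from mult_left_mono[OF this assms(2)]
  show "x * (\<integral>k. c * f (x + k) y \<partial>P) + y * (\<integral>k. c * f x (y + k) \<partial>Q) \<le> (x + y) * (c * f x y)"
    by (simp add: algebra_simps)
qed

text \<open>An affine majorant of the increment in \<open>k\<close> integrates to its value at the
  mean \<open>m\<close>, so superharmonicity reduces to the sign of a weighted sum of two such
  values.\<close>

lemma superharmonicI:
  assumes "\<And>x y. 0 < x \<Longrightarrow> 0 < y \<Longrightarrow> R \<le> x + y \<Longrightarrow>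
      continuous_on {0..\<beta>} (\<lambda>k. h (x + k) y) \<and> continuous_on {0..\<beta>} (\<lambda>k. h x (y + k))"
    and "\<And>x y. 0 < x \<Longrightarrow> 0 < y \<Longrightarrow> R \<le> x + y \<Longrightarrow> \<exists>a c a' c'.
      (\<forall>k. 0 \<le> k \<longrightarrow> k \<le> \<beta> \<longrightarrow> h (x + k) y \<le> a * k + (h x y + c)) \<and>
      (\<forall>k. 0 \<le> k \<longrightarrow> k \<le> \<beta> \<longrightarrow> h x (y + k) \<le> a' * k + (h x y + c')) \<and>
      x * (a * m + c) + y * (a' * m + c') \<le> 0"
  shows "superharmonic R h"
  unfolding superharmonic_def
proof (intro allI impI)
  fix x y :: real assume xy: "0 < x" "0 < y" "R \<le> x + y"
  have i: "integrable P (\<lambda>k. h (x + k) y)" "integrable Q (\<lambda>k. h x (y + k))"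
    using assms(1)[OF xy] by (auto intro: integrable_continuous)
  obtain a c a' c' where
    1: "\<And>k. 0 \<le> k \<Longrightarrow> k \<le> \<beta> \<Longrightarrow> h (x + k) y \<le> a * k + (h x y + c)"
    and 2: "\<And>k. 0 \<le> k \<Longrightarrow> k \<le> \<beta> \<Longrightarrow> h x (y + k) \<le> a' * k + (h x y + c')"
    and 3: "x * (a * m + c) + y * (a' * m + c') \<le> 0"
    using assms(2)[OF xy] by blast
  have "x * (\<integral>k. h (x + k) y \<partial>P) + y * (\<integral>k. h x (y + k) \<partial>Q)
      \<le> x * (a * m + (h x y + c)) + y * (a' * m + (h x y + c'))"
    using xy integral_le_affine[OF _ i(1) 1] integral_le_affine[OF _ i(2) 2]
    by (intro add_mono mult_left_mono) auto
  also have "\<dots> \<le> (x + y) * h x y"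
    using 3 by (simp add: algebra_simps)
  finally show "integrable P (\<lambda>k. h (x + k) y) \<and> integrable Q (\<lambda>k. h x (y + k)) \<and>
     x * (\<integral>k. h (x + k) y \<partial>P) + y * (\<integral>k. h x (y + k) \<partial>Q) \<le> (x + y) * h x y"
    using i by blast
qed

lemma superharmonic_const: "superharmonic R (\<lambda>x y. c)"
  by (rule superharmonicI) (auto intro!: continuous_intros exI[of _ 0])

text \<open>Let \<open>M r\<close> be the infimum of \<open>h\<close> over the states with sum at
  least \<open>r\<close>. Steps are at most \<beta> with mean \<open>m\<close>, so they reach size
  \<open>m / 2\<close> with probability bounded below. A gap between \<open>M r\<close> and
  \<open>M (r + m / 2)\<close> would lift the average after one step, hence \<open>h\<close> itself,
  uniformly above \<open>M r\<close>. So \<open>M\<close> is constant along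
  \<open>R + n * (m / 2)\<close>, and \<open>inf\<close> bounds it below by any negative number far
  out.\<close>

lemma minimum_principle:
  assumes h: "superharmonic R h" and R: "0 \<le> R"
    and below: "\<And>x y. 0 < x \<Longrightarrow> 0 < y \<Longrightarrow> R \<le> x + y \<Longrightarrow> - C \<le> h x y"
    and inf: "\<And>\<epsilon>. 0 < \<epsilon> \<Longrightarrow> \<exists>S. \<forall>x>0. \<forall>y>0. S \<le> x + y \<longrightarrow> - \<epsilon> \<le> h x y"
    and xy: "0 < x" "0 < y" "R \<le> x + y"
  shows "0 \<le> h x y"
proof -
  define D where "D r = {(x, y). 0 < x \<and> 0 < y \<and> r \<le> x + y}" for r :: real
  define M where "M r = Inf ((\<lambda>(x, y). h x y) ` D r)" for r
  have bdd: "bdd_below ((\<lambda>(x, y). h x y) ` D r)" if "R \<le> r" for r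
    using below that by (intro bdd_belowI[where m = "- C"]) (auto simp: D_def)
  have M_le: "M r \<le> h x y" if "R \<le> r" "0 < x" "0 < y" "r \<le> x + y" for r x y
    unfolding M_def using that by (intro cInf_lower bdd) (auto simp: D_def image_iff)
  have M_ge: "c \<le> M r" if "\<And>x y. 0 < x \<Longrightarrow> 0 < y \<Longrightarrow> r \<le> x + y \<Longrightarrow> c \<le> h x y" for r c
    unfolding M_def
  proof (rule cInf_greatest)
    have "(1 + \<bar>r\<bar>, 1) \<in> D r" by (auto simp: D_def)
    then show "(\<lambda>(x, y). h x y) ` D r \<noteq> {}" by blast
  qed (use that in \<open>auto simp: D_def\<close>)
  have step: "M (r + m / 2) \<le> M r" if r: "R \<le> r" for r
  proof -
    define d where "d = M (r + m / 2) - M r"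
    have d: "0 \<le> d"
      using M_ge[of "r + m / 2" "M r"] M_le[OF r] m_pos by (auto simp: d_def)
    \<comment> \<open>\<open>l\<close> is the mean of the affine function
      \<open>M r + d * (k - m / 2) / \<beta>\<close> of \<open>k\<close>, which is at most
      \<open>M r\<close> for \<open>k < m / 2\<close> and at most \<open>M (r + m / 2)\<close> for
      all \<open>k \<le> \<beta>\<close>.\<close>
    define l where "l = M r + d * m / (2 * \<beta>)"
    have int: "l \<le> (\<integral>k. f k \<partial>N)"
      if N: "N = P \<or> N = Q" "integrable N f" and f: "\<And>k. 0 \<le> k \<Longrightarrow> k \<le> \<beta> \<Longrightarrow> M r \<le> f k"
        "\<And>k. 0 \<le> k \<Longrightarrow> k \<le> \<beta> \<Longrightarrow> m / 2 \<le> k \<Longrightarrow> M (r + m / 2) \<le> f k" for N f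
    proof -
      have "- f k \<le> (- (d / \<beta>)) * k + (d * m / (2 * \<beta>) - M r)" if k: "0 \<le> k" "k \<le> \<beta>" for k
      proof (cases "m / 2 \<le> k")
        case True
        have "d * (k / \<beta>) \<le> d * 1"
          using d k \<beta>_pos by (intro mult_left_mono) auto
        moreover have "0 \<le> d * m / (2 * \<beta>)"
          using d m_pos \<beta>_pos by simp
        ultimately show ?thesis
          using f(2)[OF k True] by (simp add: d_def)
      next
        case False
        then have "d / \<beta> * k \<le> d / \<beta> * (m / 2)"
          using d \<beta>_pos by (intro mult_left_mono) auto
        then show ?thesis
          using f(1)[OF k] by (simp add: mult.commute)
      qed
      then have "(\<integral>k. - f k \<partial>N) \<le> (- (d / \<beta>)) * m + (d * m / (2 * \<beta>) - M r)"
        using N by (intro integral_le_affine) auto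
      moreover have "d / \<beta> * m = 2 * (d * m / (2 * \<beta>))"
        by simp
      ultimately show ?thesis
        unfolding l_def by simp
    qed
    have "l \<le> h x y" if xy: "0 < x" "0 < y" "r \<le> x + y" for x y
    proof -
      have "R \<le> x + y" using xy r by simp
      then have i: "integrable P (\<lambda>k. h (x + k) y)" "integrable Q (\<lambda>k. h x (y + k))"
        and le: "x * (\<integral>k. h (x + k) y \<partial>P) + y * (\<integral>k. h x (y + k) \<partial>Q) \<le> (x + y) * h x y"
        using h xy unfolding superharmonic_def by blast+
      have r': "R \<le> r + m / 2" using r m_pos by simp
      have 1: "l \<le> (\<integral>k. h (x + k) y \<partial>P)"
        using xy i by (intro int M_le[OF r] M_le[OF r']) auto
      have 2: "l \<le> (\<integral>k. h x (y + k) \<partial>Q)"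
        using xy i by (intro int M_le[OF r] M_le[OF r']) auto
      have "(x + y) * l \<le> (x + y) * h x y"
        using mult_left_mono[OF 1, of x] mult_left_mono[OF 2, of y] le xy
        unfolding distrib_right by linarith
      then show ?thesis using xy by simp
    qed
    then have "l \<le> M r" by (rule M_ge)
    then have "d * m / (2 * \<beta>) \<le> 0" by (simp add: l_def)
    then have "d \<le> 0"
      using m_pos \<beta>_pos by (simp add: divide_le_0_iff mult_le_0_iff)
    then show ?thesis by (simp add: d_def)
  qed
  have iter: "M (R + real n * (m / 2)) \<le> M R" for n
  proof (induction n)
    case (Suc n)
    have eq: "R + real (Suc n) * (m / 2) = (R + real n * (m / 2)) + m / 2"
      by (simp add: field_simps)
    have "M (R + real (Suc n) * (m / 2)) \<le> M (R + real n * (m / 2))"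
      unfolding eq using m_pos by (intro step) simp
    then show ?case using Suc by (rule order_trans)
  qed simp
  have "- \<epsilon> \<le> M R" if "0 < \<epsilon>" for \<epsilon>
  proof -
    obtain S where S: "\<And>x y. 0 < x \<Longrightarrow> 0 < y \<Longrightarrow> S \<le> x + y \<Longrightarrow> - \<epsilon> \<le> h x y"
      using inf[OF \<open>0 < \<epsilon>\<close>] by blast
    obtain n :: nat where n: "S < real n * (m / 2)"
      using reals_Archimedean3[of "m / 2"] m_pos by auto
    have "- \<epsilon> \<le> M (R + real n * (m / 2))"
      using S n R by (intro M_ge) auto
    then show ?thesis using iter by (rule order_trans)
  qed
  then have "0 \<le> M R + \<epsilon>" if "0 < \<epsilon>" for \<epsilon>
    using that by (smt (verit))
  then have "0 \<le> M R" by (rule field_le_epsilon)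
  then show ?thesis using M_le[of R x y] xy by simp
qed

end

section \<open>Explicit superharmonic functions\<close>

context
  fixes b s k p :: real
  assumes b: "b \<le> s" and k: "0 \<le> k" "k \<le> b" and s: "0 < s" and p: "\<bar>p\<bar> \<le> 1"
begin


text \<open>As \<open>k \<le> b \<le> s\<close>, a step at most doubles the sum. This is the origin
  of the factor 2 here and of the factor 4 in \<open>step_square_lower\<close>.\<close>

lemma inverse_step_upper: "1 / (s + k) \<le> 1 / s - k / (2 * s\<^sup>2)"
proof -
  have "1 / s - 1 / (s + k) = k / (s * (s + k))" using s k by (simp add: field_simps)
  moreover have "k / (s * (2 * s)) \<le> k / (s * (s + k))"
    using s k b by (intro divide_left_mono mult_left_mono) auto
  ultimately show ?thesis by (simp add: power2_eq_square algebra_simps)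
qed

lemma inverse_step_lower: "1 / s - k / s\<^sup>2 \<le> 1 / (s + k)"
proof -
  have "1 / s - 1 / (s + k) = k / (s * (s + k))" using s k by (simp add: field_simps)
  moreover have "k / (s * (s + k)) \<le> k / (s * s)"
    using s k b by (intro divide_left_mono mult_left_mono) auto
  ultimately show ?thesis by (simp add: power2_eq_square)
qed

lemma inverse_square_step: "1 / (s + k)\<^sup>2 \<le> 1 / s\<^sup>2 - k / (2 * s ^ 3)"
proof -
  have 1: "1 / (s + k) \<le> 1 / s - k / (2 * s\<^sup>2)" by (rule inverse_step_upper)
  have 2: "1 / (s + k) \<le> 1 / s" using s k by (intro divide_left_mono) auto
  have "1 / (s + k) * (1 / (s + k)) \<le> (1 / s - k / (2 * s\<^sup>2)) * (1 / s)"
    using s k by (intro mult_mono 1 2 order_trans[OF _ 1]) auto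
  also have "\<dots> = 1 / s\<^sup>2 - k / (2 * s ^ 3)"
    using s by (simp add: field_simps power2_eq_square power3_eq_cube)
  finally show ?thesis by (simp add: power2_eq_square)
qed

text \<open>\<open>k * p / (s + k)\<close> is the displacement of the proportion and
  \<open>p * k / s\<close> its linear part, whose mean cancels between the two directions. In the
  second-order error one factor \<open>k\<close> is bounded by \<open>b\<close>, which keeps the
  bound linear in \<open>k\<close>.\<close>

lemma step_drift: "\<bar>k * p / (s + k) - p * k / s\<bar> \<le> b * k / s\<^sup>2"
proof -
  have "\<bar>k * p / (s + k) - p * k / s\<bar> = \<bar>p\<bar> * (k * k / (s * (s + k)))"
    using s k by (simp add: field_simps abs_mult) 
  also have "\<dots> \<le> 1 * (b * k / (s * s))"
    using s k p by (intro mult_mono frac_le) auto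
  finally show ?thesis by (simp add: power2_eq_square)
qed

lemma step_square_upper: "(k * p / (s + k))\<^sup>2 \<le> b * k / s\<^sup>2"
proof -
  have "(k * p / (s + k))\<^sup>2 = p\<^sup>2 * (k * k / (s + k)\<^sup>2)"
    by (simp add: power_divide power_mult_distrib power2_eq_square)
  also have "\<dots> \<le> 1 * (b * k / s\<^sup>2)"
    using s k p by (intro mult_mono frac_le power_mono) (auto simp: abs_square_le_1)
  finally show ?thesis by simp
qed

lemma step_square_lower: "(p * k)\<^sup>2 / (4 * s\<^sup>2) \<le> (k * p / (s + k))\<^sup>2"
proof -
  have "(p * k)\<^sup>2 / (2 * s)\<^sup>2 \<le> (p * k)\<^sup>2 / (s + k)\<^sup>2"
    using s k b by (intro divide_left_mono power_mono) auto
  then show ?thesis by (simp add: power_divide power_mult_distrib mult.commute)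
qed

lemma step_product: "\<bar>c * (k * p / (s + k) - p * k / s)\<bar> \<le> \<bar>c\<bar> * (b * k / s\<^sup>2)"
  using mult_left_mono[OF step_drift, of "\<bar>c\<bar>"] by (simp add: abs_mult)

lemma quadratic_step_upper:
  "(\<tau> + k * p / (s + k))\<^sup>2
    \<le> \<tau>\<^sup>2 + 2 * \<tau> / s * p * k + (2 * \<bar>\<tau>\<bar> + 1) * (b * k / s\<^sup>2)"
proof -
  have "(\<tau> + k * p / (s + k))\<^sup>2 = \<tau>\<^sup>2 + 2 * \<tau> / s * p * k
      + 2 * \<tau> * (k * p / (s + k) - p * k / s) + (k * p / (s + k))\<^sup>2"
    by (simp add: power2_eq_square algebra_simps)
  moreover have "(2 * \<bar>\<tau>\<bar> + 1) * (b * k / s\<^sup>2) = \<bar>2 * \<tau>\<bar> * (b * k / s\<^sup>2) + b * k / s\<^sup>2"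
    by (simp add: distrib_right abs_mult add_divide_distrib)
  ultimately show ?thesis
    using step_product[of "2 * \<tau>"] step_square_upper by linarith
qed

lemma quadratic_step_lower:
  "\<tau>\<^sup>2 + 2 * \<tau> / s * p * k - 2 * \<bar>\<tau>\<bar> * (b * k / s\<^sup>2) + (p * k)\<^sup>2 / (4 * s\<^sup>2)
    \<le> (\<tau> + k * p / (s + k))\<^sup>2"
proof -
  have "(\<tau> + k * p / (s + k))\<^sup>2 = \<tau>\<^sup>2 + 2 * \<tau> / s * p * k
      + 2 * \<tau> * (k * p / (s + k) - p * k / s) + (k * p / (s + k))\<^sup>2"
    by (simp add: power2_eq_square algebra_simps)
  then show ?thesis
    using step_product[of "2 * \<tau>"] step_square_lower by (simp add: algebra_simps abs_mult)
qed

text \<open>The cubic term of the binomial expansion is split between its neighbours, which leaves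
  the coefficients 8 and 3. Replacing the displacement by its linear part in the first-order term
  costs 4 more, whence 12.\<close>

lemma quartic_step:
  assumes "\<bar>\<tau>\<bar> \<le> 1"
  shows "(\<tau> + k * p / (s + k)) ^ 4
    \<le> \<tau> ^ 4 + 4 * \<tau> ^ 3 / s * p * k + 12 * \<tau>\<^sup>2 * (b * k / s\<^sup>2) + 3 * b\<^sup>2 * k / s ^ 3"
proof -
  define d where "d = k * p / (s + k)"
  have d2: "d\<^sup>2 \<le> b * k / s\<^sup>2" unfolding d_def by (rule step_square_upper)
  have "4 * \<tau> * d ^ 3 \<le> 2 * \<tau>\<^sup>2 * d\<^sup>2 + 2 * d ^ 4"
  proof -
    have "0 \<le> 2 * d\<^sup>2 * (\<tau> - d)\<^sup>2" by simp
    then show ?thesis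
      by (simp add: power2_eq_square power3_eq_cube power4_eq_xxxx algebra_simps)
  qed
  then have "(\<tau> + d) ^ 4 \<le> \<tau> ^ 4 + 4 * \<tau> ^ 3 * d + 8 * \<tau>\<^sup>2 * d\<^sup>2 + 3 * d ^ 4"
    by (simp add: power2_eq_square power3_eq_cube power4_eq_xxxx algebra_simps)
  moreover have "4 * \<tau> ^ 3 * d \<le> 4 * \<tau> ^ 3 / s * p * k + 4 * \<tau>\<^sup>2 * (b * k / s\<^sup>2)"
  proof -
    have "\<bar>4 * \<tau> ^ 3\<bar> = 4 * (\<tau>\<^sup>2 * \<bar>\<tau>\<bar>)"
      by (simp add: abs_mult power2_eq_square power3_eq_cube)
    also have "\<dots> \<le> 4 * (\<tau>\<^sup>2 * 1)"
      using assms by (intro mult_left_mono) auto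
    finally have "\<bar>4 * \<tau> ^ 3\<bar> * (b * k / s\<^sup>2) \<le> 4 * \<tau>\<^sup>2 * (b * k / s\<^sup>2)"
      using s k by (intro mult_right_mono) auto
    then show ?thesis
      using step_product[of "4 * \<tau> ^ 3"] unfolding d_def by (simp add: algebra_simps)
  qed
  moreover have "8 * \<tau>\<^sup>2 * d\<^sup>2 \<le> 8 * \<tau>\<^sup>2 * (b * k / s\<^sup>2)"
    by (intro mult_left_mono d2) auto
  moreover have "d ^ 4 \<le> b\<^sup>2 * k / s ^ 3"
  proof -
    have "d ^ 4 = d\<^sup>2 * d\<^sup>2" by (simp add: power2_eq_square power4_eq_xxxx)
    also have "\<dots> \<le> (b * k / s\<^sup>2) * (b * k / s\<^sup>2)"
      using d2 s k by (intro mult_mono) auto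
    also have "\<dots> = b\<^sup>2 * k / s ^ 3 * (k / s)"
      by (simp add: power2_eq_square power3_eq_cube mult_ac)
    also have "\<dots> \<le> b\<^sup>2 * k / s ^ 3 * 1"
      using s k b by (intro mult_left_mono) auto
    finally show ?thesis by simp
  qed
  moreover have "12 * \<tau>\<^sup>2 * (b * k / s\<^sup>2) = 4 * \<tau>\<^sup>2 * (b * k / s\<^sup>2) + 8 * \<tau>\<^sup>2 * (b * k / s\<^sup>2)"
    and "3 * b\<^sup>2 * k / s ^ 3 = 3 * (b\<^sup>2 * k / s ^ 3)"
    by simp_all
  ultimately show ?thesis unfolding d_def by linarith
qed

text \<open>The negative term comes from the growth of the denominator. It is the gain that pays for
  the error of order \<open>\<tau>\<^sup>2\<close> in \<open>quartic_step\<close>.\<close>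

lemma quadratic_over_sum_step:
  assumes "\<bar>\<tau>\<bar> \<le> 1"
  shows "(\<tau> + k * p / (s + k))\<^sup>2 / (s + k)
    \<le> \<tau>\<^sup>2 / s + 2 * \<tau> / s\<^sup>2 * p * k - \<tau>\<^sup>2 * k / (2 * s\<^sup>2) + 5 * b * k / s ^ 3"
proof -
  define d where "d = k * p / (s + k)"
  have d2: "d\<^sup>2 \<le> b * k / s\<^sup>2" unfolding d_def by (rule step_square_upper)
  have "(\<tau> + d)\<^sup>2 / (s + k) = \<tau>\<^sup>2 * (1 / (s + k)) + 2 * \<tau> * (d / (s + k)) + d\<^sup>2 / (s + k)"
    by (simp add: power2_eq_square add_divide_distrib algebra_simps)
  moreover have "\<tau>\<^sup>2 * (1 / (s + k)) \<le> \<tau>\<^sup>2 * (1 / s - k / (2 * s\<^sup>2))"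
    by (intro mult_left_mono inverse_step_upper) auto
  moreover have "d\<^sup>2 / (s + k) \<le> b * k / s ^ 3"
  proof -
    have "d\<^sup>2 / (s + k) \<le> (b * k / s\<^sup>2) / s" using d2 s k by (intro frac_le) auto
    then show ?thesis by (simp add: power2_eq_square power3_eq_cube)
  qed
  moreover have "2 * \<tau> * (d / (s + k)) \<le> 2 * \<tau> / s\<^sup>2 * p * k + 4 * b * k / s ^ 3"
  proof -
    have "1 / s\<^sup>2 - 1 / (s + k)\<^sup>2 = (1 / s - 1 / (s + k)) * (1 / s + 1 / (s + k))"
      by (simp add: power2_eq_square algebra_simps)
    also have "\<dots> \<le> (k / s\<^sup>2) * (1 / s + 1 / s)"
      using inverse_step_lower s k by (intro mult_mono add_mono divide_left_mono) auto
    also have "\<dots> = 2 * k / s ^ 3"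
      using s by (simp add: field_simps power2_eq_square power3_eq_cube)
    finally have 1: "1 / s\<^sup>2 - 1 / (s + k)\<^sup>2 \<le> 2 * k / s ^ 3" .
    have 2: "0 \<le> 1 / s\<^sup>2 - 1 / (s + k)\<^sup>2"
      using s k by (auto intro!: frac_le power_mono)
    have "\<bar>2 * \<tau> * p * k\<bar> \<le> 2 * (1 * 1) * b"
      using assms p k unfolding abs_mult mult.assoc by (intro mult_mono) auto
    then have "\<bar>2 * \<tau> * p * k * (1 / s\<^sup>2 - 1 / (s + k)\<^sup>2)\<bar> \<le> 2 * b * (2 * k / s ^ 3)"
      using 1 2 k unfolding abs_mult[of _ "1 / s\<^sup>2 - 1 / (s + k)\<^sup>2"]
      by (intro mult_mono) auto
    moreover have "2 * \<tau> * (d / (s + k))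
        = 2 * \<tau> / s\<^sup>2 * p * k - 2 * \<tau> * p * k * (1 / s\<^sup>2 - 1 / (s + k)\<^sup>2)"
      by (simp add: d_def power2_eq_square algebra_simps)
    ultimately show ?thesis by simp
  qed
  ultimately show ?thesis unfolding d_def by (simp add: algebra_simps)
qed

end

section \<open>Superharmonicity of the distance, the bump and the logarithm\<close>

context urn
begin

text \<open>A step of size \<open>k\<close> moves the proportion by \<open>k * p / (s + k)\<close>, where \<open>p\<close> is \<open>y / s\<close> or \<open>- x / s\<close>. As the
  steps have equal means, the terms linear in \<open>p * k\<close> cancel, and those in \<open>(p * k)\<^sup>2\<close> contribute at
  least \<open>m\<^sup>2 t (1 - t)\<close>.\<close>

lemma superharmonic_polar:
  fixes F a e \<gamma> :: "real \<Rightarrow> real \<Rightarrow> real"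
  assumes R: "0 < R" and t0: "0 \<le> t0" "t0 \<le> 1"
    and cont: "continuous_on {q. 0 < snd q} (\<lambda>q. F (fst q) (snd q))"
    and step: "\<And>\<tau> s p k. \<bar>\<tau>\<bar> \<le> 1 \<Longrightarrow> R \<le> s \<Longrightarrow> \<bar>p\<bar> \<le> 1 \<Longrightarrow> 0 \<le> k \<Longrightarrow> k \<le> \<beta> \<Longrightarrow>
      F (\<tau> + k * p / (s + k)) (s + k)
        \<le> F \<tau> s + a \<tau> s * p * k + e \<tau> s * k - \<gamma> \<tau> s * (p * k)\<^sup>2"
    and \<gamma>: "\<And>\<tau> s. 0 \<le> \<gamma> \<tau> s"
    and e: "\<And>t s. 0 < t \<Longrightarrow> t < 1 \<Longrightarrow> R \<le> s \<Longrightarrow>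
      e (t - t0) s \<le> \<gamma> (t - t0) s * m * (t * (1 - t))"
  shows "superharmonic R (\<lambda>x y. F (x / (x + y) - t0) (x + y))"
proof (rule superharmonicI)
  fix x y :: real assume xy: "0 < x" "0 < y" "R \<le> x + y"
  have 1: "continuous_on {0..\<beta>} (\<lambda>k. F (fst (q k)) (snd (q k)))"
    if "continuous_on {0..\<beta>} q" "\<And>k. 0 \<le> k \<Longrightarrow> 0 < snd (q k)" for q
    using that by (intro continuous_on_compose2[OF cont]) auto
  have "continuous_on {0..\<beta>} (\<lambda>k. ((x + k) / (x + k + y) - t0, x + k + y))"
    "continuous_on {0..\<beta>} (\<lambda>k. (x / (x + (y + k)) - t0, x + (y + k)))"
    using xy by (auto intro!: continuous_intros)
  from this[THEN 1] show "continuous_on {0..\<beta>} (\<lambda>k. F ((x + k) / (x + k + y) - t0) (x + k + y)) \<and>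
      continuous_on {0..\<beta>} (\<lambda>k. F (x / (x + (y + k)) - t0) (x + (y + k)))"
    using xy by auto
next
  fix x y :: real assume xy: "0 < x" "0 < y" "R \<le> x + y"
  define s t where "s = x + y" and "t = x / (x + y)"
  have s: "0 < s" "R \<le> s" using xy by (auto simp: s_def)
  have t: "0 < t" "t < 1" using xy by (auto simp: t_def)
  have x: "x = s * t" and y: "y = s * (1 - t)" using xy by (auto simp: s_def t_def field_simps)
  define A E \<Gamma> where "A = a (t - t0) s" and "E = e (t - t0) s" and "\<Gamma> = \<gamma> (t - t0) s"
  have \<tau>: "\<bar>t - t0\<bar> \<le> 1" using t t0 by auto
  \<comment> \<open>\<open>(p * k)\<^sup>2\<close> is convex in \<open>k\<close> and enters with a
    negative sign, so it may be replaced by its tangent at \<open>m\<close>; the majorant becomes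
    affine in \<open>k\<close>.\<close>
  have bound: "F ((t - t0) + k * p / (s + k)) (s + k)
      \<le> (A * p + E - 2 * m * \<Gamma> * p\<^sup>2) * k + (F (t - t0) s + \<Gamma> * p\<^sup>2 * m\<^sup>2)"
    if "\<bar>p\<bar> \<le> 1" "0 \<le> k" "k \<le> \<beta>" for p k
  proof -
    have "0 \<le> \<Gamma> * p\<^sup>2 * (k - m)\<^sup>2" using \<gamma> by (auto simp: \<Gamma>_def)
    then show ?thesis
      using step[OF \<tau> s(2) that] unfolding A_def[symmetric] E_def[symmetric] \<Gamma>_def[symmetric]
      by (simp add: power2_eq_square algebra_simps)
  qed
  have X: "(x + k) / (x + k + y) - t0 = (t - t0) + k * (1 - t) / (s + k)" "x + k + y = s + k"
    if "0 \<le> k" for k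
    unfolding x y using s that by (auto simp: field_simps)
  have Y: "x / (x + (y + k)) - t0 = (t - t0) + k * (- t) / (s + k)" "x + (y + k) = s + k"
    if "0 \<le> k" for k
    unfolding x y using s that by (auto simp: field_simps)
  \<comment> \<open>The terms with \<open>A\<close> cancel because
    \<open>x * (1 - t) = y * t\<close>. The factor \<open>t * (1 - t)\<close> is the sum of
    \<open>t * (1 - t)\<^sup>2\<close> and \<open>(1 - t) * t\<^sup>2\<close>.\<close>
  have eq: "x * (A' * m + c) + y * (B' * m + c') = s * m * (E - \<Gamma> * m * (t * (1 - t)))"
    if "A' = A * (1 - t) + E - 2 * m * \<Gamma> * (1 - t)\<^sup>2" "c = \<Gamma> * (1 - t)\<^sup>2 * m\<^sup>2"
      "B' = A * (- t) + E - 2 * m * \<Gamma> * (- t)\<^sup>2" "c' = \<Gamma> * (- t)\<^sup>2 * m\<^sup>2" for A' B' c c'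
    unfolding that x y by (simp add: power2_eq_square algebra_simps)
  have "E - \<Gamma> * m * (t * (1 - t)) \<le> 0"
    using e[OF t s(2)] by (simp add: E_def \<Gamma>_def)
  then have le: "s * m * (E - \<Gamma> * m * (t * (1 - t))) \<le> 0"
    using s m_pos by (simp add: mult_le_0_iff)
  show "\<exists>a c a' c'.
      (\<forall>k. 0 \<le> k \<longrightarrow> k \<le> \<beta> \<longrightarrow> F ((x + k) / (x + k + y) - t0) (x + k + y)
         \<le> a * k + (F (x / (x + y) - t0) (x + y) + c)) \<and>
      (\<forall>k. 0 \<le> k \<longrightarrow> k \<le> \<beta> \<longrightarrow> F (x / (x + (y + k)) - t0) (x + (y + k))
         \<le> a' * k + (F (x / (x + y) - t0) (x + y) + c')) \<and>
      x * (a * m + c) + y * (a' * m + c') \<le> 0"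
    unfolding t_def[symmetric] unfolding s_def[symmetric]
  proof (intro exI conjI allI impI)
    fix k assume k: "0 \<le> k" "k \<le> \<beta>"
    show "F ((x + k) / (x + k + y) - t0) (x + k + y) \<le>
      (A * (1 - t) + E - 2 * m * \<Gamma> * (1 - t)\<^sup>2) * k + (F (t - t0) s + \<Gamma> * (1 - t)\<^sup>2 * m\<^sup>2)"
      unfolding X(1)[OF k(1)] unfolding X(2)[OF k(1)] using t k by (intro bound) auto
    show "F (x / (x + (y + k)) - t0) (x + (y + k)) \<le>
      (A * (- t) + E - 2 * m * \<Gamma> * (- t)\<^sup>2) * k + (F (t - t0) s + \<Gamma> * (- t)\<^sup>2 * m\<^sup>2)"
      unfolding Y(1)[OF k(1)] unfolding Y(2)[OF k(1)] using t k by (intro bound) auto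
  qed (use eq[OF refl refl refl refl] le in linarith)
qed

text \<open>Beyond its linear part, a step adds at most \<open>3 * \<beta> * k / s\<^sup>2\<close>
  to the square, as \<open>2 * \<bar>\<tau>\<bar> + 1 \<le> 3\<close>; the summand
  \<open>6 * \<beta> / s\<close> decreases by at least as much. With the minimum principle this
  controls how far the proportion can still move.\<close>

lemma superharmonic_distance:
  assumes "0 \<le> t0" "t0 \<le> 1"
  shows "superharmonic \<beta> (\<lambda>x y. (x / (x + y) - t0)\<^sup>2 + 6 * \<beta> / (x + y))"
proof (rule superharmonic_polar[where F = "\<lambda>\<tau> s. \<tau>\<^sup>2 + 6 * \<beta> / s" and a = "\<lambda>\<tau> s. 2 * \<tau> / s"
      and e = "\<lambda>\<tau> s. 0" and \<gamma> = "\<lambda>\<tau> s. 0"])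
  fix \<tau> s p k :: real
  assume *: "\<bar>\<tau>\<bar> \<le> 1" "\<beta> \<le> s" "\<bar>p\<bar> \<le> 1" "0 \<le> k" "k \<le> \<beta>"
  then have s: "0 < s" using \<beta>_pos by simp
  have "(2 * \<bar>\<tau>\<bar> + 1) * (\<beta> * k / s\<^sup>2) \<le> 3 * (\<beta> * k / s\<^sup>2)"
    using * \<beta>_pos by (intro mult_right_mono) auto
  moreover have "6 * \<beta> * (1 / (s + k)) \<le> 6 * \<beta> * (1 / s - k / (2 * s\<^sup>2))"
    using * s \<beta>_pos by (intro mult_left_mono inverse_step_upper) auto
  moreover have "6 * \<beta> * (k / (2 * s\<^sup>2)) = 3 * (\<beta> * k / s\<^sup>2)" by simp
  ultimately show "(\<tau> + k * p / (s + k))\<^sup>2 + 6 * \<beta> / (s + k)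
      \<le> \<tau>\<^sup>2 + 6 * \<beta> / s + 2 * \<tau> / s * p * k + 0 * k - 0 * (p * k)\<^sup>2"
    using quadratic_step_upper[OF *(2,4,5) s *(3), of \<tau>] by (simp add: right_diff_distrib)
qed (use assms \<beta>_pos in \<open>auto intro!: continuous_intros\<close>)

text \<open>A superharmonic substitute for \<open>(1 - \<alpha> \<tau>\<^sup>2)\<^sup>2\<close>, which is 1 on the ray \<open>\<tau> = 0\<close>. From the state
  \<open>(\<tau>, s)\<close> the limiting proportion has variance at least of order \<open>t0 (1 - t0) / s\<close>, which is the
  term added to \<open>\<tau>\<^sup>2\<close>; the terms added to \<open>\<tau> ^ 4\<close> absorb the drift and the higher moments of a step.\<close>

definition bump :: "real \<Rightarrow> real \<Rightarrow> real \<Rightarrow> real \<Rightarrow> real" where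
  "bump t0 \<alpha> \<tau> s = 1 - 2 * \<alpha> * (\<tau>\<^sup>2 + m * t0 * (1 - t0) / 8 / s)
     + \<alpha>\<^sup>2 * (\<tau> ^ 4 + 26 * \<beta> * \<tau>\<^sup>2 / s + 266 * \<beta>\<^sup>2 / s\<^sup>2)"

text \<open>Second-order errors and the difference between \<open>t * (1 - t)\<close> and
  \<open>t0 * (1 - t0)\<close> cost at most \<open>5 * \<beta> * \<bar>\<tau>\<bar>\<close>. With
  \<open>v = m * t0 * (1 - t0)\<close>, the inequality between arithmetic and geometric means bounds
  this by \<open>v / 4 + 25 * \<beta>\<^sup>2 * \<tau>\<^sup>2 / v\<close>. The condition on
  \<alpha> makes the last term at most the gain \<open>\<alpha> * \<beta> * \<tau>\<^sup>2\<close>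
  of the quartic part.\<close>

lemma superharmonic_bump:
  assumes t0: "0 < t0" "t0 < 1" and \<alpha>: "25 * \<beta> \<le> \<alpha> * (m * t0 * (1 - t0))"
  shows "superharmonic \<beta> (\<lambda>x y. bump t0 \<alpha> (x / (x + y) - t0) (x + y))"
proof (rule superharmonic_polar[where F = "bump t0 \<alpha>"
      and a = "\<lambda>\<tau> s. - 4 * \<alpha> * \<tau> / s + \<alpha>\<^sup>2 * (4 * \<tau> ^ 3 / s + 52 * \<beta> * \<tau> / s\<^sup>2)"
      and e = "\<lambda>\<tau> s. \<alpha> * (4 * (\<beta> * \<bar>\<tau>\<bar>) + m * t0 * (1 - t0) / 4 - \<alpha> * (\<beta> * \<tau>\<^sup>2)) / s\<^sup>2"
      and \<gamma> = "\<lambda>\<tau> s. \<alpha> / (2 * s\<^sup>2)"])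
  define v where "v = m * t0 * (1 - t0)"
  have v: "0 < v" using t0 m_pos by (simp add: v_def)
  have \<alpha>_pos: "0 < \<alpha>"
  proof -
    have "0 < \<alpha> * v" using \<alpha> \<beta>_pos unfolding v_def by linarith
    then show ?thesis using v by (simp add: zero_less_mult_iff)
  qed
  show "0 \<le> \<alpha> / (2 * s\<^sup>2)" for s :: real using \<alpha>_pos by simp
  show "continuous_on {q. 0 < snd q} (\<lambda>q. bump t0 \<alpha> (fst q) (snd q))"
    unfolding bump_def by (intro continuous_intros) auto
  fix t s :: real assume t: "0 < t" "t < 1" and s: "\<beta> \<le> s"
  define \<tau> where "\<tau> = t - t0"
  have "t0 * (1 - t0) - \<bar>\<tau>\<bar> \<le> t * (1 - t)"
  proof -
    have "t * (1 - t) = t0 * (1 - t0) + \<tau> * (1 - t - t0)"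
      by (simp add: \<tau>_def algebra_simps)
    moreover have "\<bar>\<tau> * (1 - t - t0)\<bar> \<le> \<bar>\<tau>\<bar> * 1"
      unfolding abs_mult using t t0 by (intro mult_left_mono) auto
    ultimately show ?thesis by linarith
  qed
  then have "m * (t0 * (1 - t0) - \<bar>\<tau>\<bar>) \<le> m * (t * (1 - t))"
    using m_pos by (intro mult_left_mono) auto
  moreover have "m * \<bar>\<tau>\<bar> \<le> \<beta> * \<bar>\<tau>\<bar>" using m_le by (intro mult_right_mono) auto
  moreover have "5 * \<beta> * \<bar>\<tau>\<bar> \<le> v / 4 + \<alpha> * \<beta> * \<tau>\<^sup>2"
  proof -
    have "0 \<le> (v - 10 * \<beta> * \<bar>\<tau>\<bar>)\<^sup>2" by simp
    then have "20 * \<beta> * \<bar>\<tau>\<bar> * v \<le> v\<^sup>2 + 4 * (25 * \<beta>) * \<beta> * \<tau>\<^sup>2"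
      by (simp add: power2_eq_square algebra_simps)
    also have "\<dots> \<le> v\<^sup>2 + 4 * (\<alpha> * v) * \<beta> * \<tau>\<^sup>2"
      using \<alpha> \<beta>_pos unfolding v_def by (intro add_left_mono mult_right_mono mult_left_mono) auto
    finally have "v * (20 * \<beta> * \<bar>\<tau>\<bar>) \<le> v * (v + 4 * \<alpha> * \<beta> * \<tau>\<^sup>2)"
      by (simp add: power2_eq_square algebra_simps)
    then show ?thesis using v by simp
  qed
  ultimately have "4 * (\<beta> * \<bar>\<tau>\<bar>) + v / 4 - \<alpha> * (\<beta> * \<tau>\<^sup>2) \<le> m * (t * (1 - t)) / 2"
  proof -
    have "m * (t0 * (1 - t0) - \<bar>\<tau>\<bar>) = v - m * \<bar>\<tau>\<bar>"
      by (simp add: v_def algebra_simps)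
    moreover have "0 \<le> \<beta> * \<bar>\<tau>\<bar>" using \<beta>_pos by simp
    ultimately show ?thesis
      using \<open>m * (t0 * (1 - t0) - \<bar>\<tau>\<bar>) \<le> m * (t * (1 - t))\<close> \<open>m * \<bar>\<tau>\<bar> \<le> \<beta> * \<bar>\<tau>\<bar>\<close>
        \<open>5 * \<beta> * \<bar>\<tau>\<bar> \<le> v / 4 + \<alpha> * \<beta> * \<tau>\<^sup>2\<close> unfolding mult.assoc by linarith
  qed
  then have "\<alpha> * (4 * (\<beta> * \<bar>\<tau>\<bar>) + v / 4 - \<alpha> * (\<beta> * \<tau>\<^sup>2)) / s\<^sup>2 \<le> \<alpha> * (m * (t * (1 - t)) / 2) / s\<^sup>2"
    using \<alpha>_pos by (intro divide_right_mono mult_left_mono) auto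
  then show "\<alpha> * (4 * (\<beta> * \<bar>t - t0\<bar>) + m * t0 * (1 - t0) / 4 - \<alpha> * (\<beta> * (t - t0)\<^sup>2)) / s\<^sup>2
      \<le> \<alpha> / (2 * s\<^sup>2) * m * (t * (1 - t))"
    by (simp add: \<tau>_def v_def mult_ac)
next
  fix \<tau> s p k :: real
  assume *: "\<bar>\<tau>\<bar> \<le> 1" "\<beta> \<le> s" "\<bar>p\<bar> \<le> 1" "0 \<le> k" "k \<le> \<beta>"
  then have s: "0 < s" using \<beta>_pos by simp
  define v where "v = m * t0 * (1 - t0)"
  have v: "0 < v" using t0 m_pos by (simp add: v_def)
  have \<alpha>_pos: "0 < \<alpha>"
  proof -
    have "0 < \<alpha> * v" using \<alpha> \<beta>_pos unfolding v_def by linarith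
    then show ?thesis using v by (simp add: zero_less_mult_iff)
  qed
  define \<tau>' where "\<tau>' = \<tau> + k * p / (s + k)"
  have 1: "\<tau>\<^sup>2 + v / 8 / s + 2 * \<tau> / s * p * k - (2 * (\<beta> * \<bar>\<tau>\<bar>) + v / 8) * (k / s\<^sup>2)
      + (p * k)\<^sup>2 / (4 * s\<^sup>2) \<le> \<tau>'\<^sup>2 + v / 8 / (s + k)"
  proof -
    have "v / 8 * (1 / s - k / s\<^sup>2) \<le> v / 8 * (1 / (s + k))"
      using * s v by (intro mult_left_mono inverse_step_lower[where b = \<beta>]) auto
    then show ?thesis
      using quadratic_step_lower[OF *(2,4,5) s *(3), of \<tau>]
      unfolding \<tau>'_def by (simp add: right_diff_distrib algebra_simps)
  qed
  \<comment> \<open>The coefficients 26 and 266 are chosen for this estimate: a gain of 13 against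
    the 12 of \<open>quartic_step\<close> leaves one unit of
    \<open>\<beta> * \<tau>\<^sup>2 * (k / s\<^sup>2)\<close>, and \<open>133 = 130 + 3\<close>
    cancels the terms of order \<open>k / s ^ 3\<close>.\<close>
  have 2: "\<tau>' ^ 4 + 26 * \<beta> * \<tau>'\<^sup>2 / (s + k) + 266 * \<beta>\<^sup>2 / (s + k)\<^sup>2
      \<le> \<tau> ^ 4 + 26 * \<beta> * \<tau>\<^sup>2 / s + 266 * \<beta>\<^sup>2 / s\<^sup>2 + (4 * \<tau> ^ 3 / s + 52 * \<beta> * \<tau> / s\<^sup>2) * p * k
        - \<beta> * \<tau>\<^sup>2 * (k / s\<^sup>2)"
  proof -
    have "266 * \<beta>\<^sup>2 * (1 / (s + k)\<^sup>2) \<le> 266 * \<beta>\<^sup>2 * (1 / s\<^sup>2 - k / (2 * s ^ 3))"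
      using * s by (intro mult_left_mono inverse_square_step) auto
    also have "\<dots> = 266 * \<beta>\<^sup>2 / s\<^sup>2 - 133 * (\<beta>\<^sup>2 * (k / s ^ 3))"
      by (simp add: right_diff_distrib)
    finally have a: "266 * \<beta>\<^sup>2 / (s + k)\<^sup>2 \<le> 266 * \<beta>\<^sup>2 / s\<^sup>2 - 133 * (\<beta>\<^sup>2 * (k / s ^ 3))"
      by simp
    have "26 * \<beta> * (\<tau>'\<^sup>2 / (s + k)) \<le> 26 * \<beta> *
        (\<tau>\<^sup>2 / s + 2 * \<tau> / s\<^sup>2 * p * k - \<tau>\<^sup>2 * k / (2 * s\<^sup>2) + 5 * \<beta> * k / s ^ 3)"
      unfolding \<tau>'_def using * s \<beta>_pos by (intro mult_left_mono quadratic_over_sum_step) auto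
    also have "\<dots> = 26 * \<beta> * \<tau>\<^sup>2 / s + 52 * \<beta> * \<tau> / s\<^sup>2 * p * k
        - 13 * (\<beta> * \<tau>\<^sup>2 * (k / s\<^sup>2)) + 130 * (\<beta>\<^sup>2 * (k / s ^ 3))"
      by (simp add: distrib_left right_diff_distrib power2_eq_square[of \<beta>] mult_ac)
    finally have b: "26 * \<beta> * \<tau>'\<^sup>2 / (s + k) \<le> 26 * \<beta> * \<tau>\<^sup>2 / s + 52 * \<beta> * \<tau> / s\<^sup>2 * p * k
        - 13 * (\<beta> * \<tau>\<^sup>2 * (k / s\<^sup>2)) + 130 * (\<beta>\<^sup>2 * (k / s ^ 3))"
      by simp
    have "\<tau>' ^ 4 \<le> \<tau> ^ 4 + 4 * \<tau> ^ 3 / s * p * k + 12 * \<tau>\<^sup>2 * (\<beta> * k / s\<^sup>2)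
        + 3 * \<beta>\<^sup>2 * k / s ^ 3"
      unfolding \<tau>'_def by (rule quartic_step[OF *(2,4,5) s *(3,1)])
    also have "\<dots> = \<tau> ^ 4 + 4 * \<tau> ^ 3 / s * p * k + 12 * (\<beta> * \<tau>\<^sup>2 * (k / s\<^sup>2))
        + 3 * (\<beta>\<^sup>2 * (k / s ^ 3))"
      by (simp add: mult_ac)
    finally show ?thesis using a b unfolding distrib_right by linarith
  qed
  have le: "bump t0 \<alpha> \<tau>' (s + k) \<le> 1 - 2 * \<alpha> * (\<tau>\<^sup>2 + v / 8 / s + 2 * \<tau> / s * p * k
      - (2 * (\<beta> * \<bar>\<tau>\<bar>) + v / 8) * (k / s\<^sup>2) + (p * k)\<^sup>2 / (4 * s\<^sup>2))
      + \<alpha>\<^sup>2 * (\<tau> ^ 4 + 26 * \<beta> * \<tau>\<^sup>2 / s + 266 * \<beta>\<^sup>2 / s\<^sup>2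
        + (4 * \<tau> ^ 3 / s + 52 * \<beta> * \<tau> / s\<^sup>2) * p * k - \<beta> * \<tau>\<^sup>2 * (k / s\<^sup>2))" (is "_ \<le> ?R")
  proof -
    have "1 - 2 * \<alpha> * A' + \<alpha>\<^sup>2 * B \<le> 1 - 2 * \<alpha> * A + \<alpha>\<^sup>2 * B'" if "A \<le> A'" "B \<le> B'" for A A' B B'
      using that \<alpha>_pos by (intro add_mono diff_mono mult_left_mono) auto
    from this[OF 1 2] show ?thesis unfolding bump_def v_def[symmetric] .
  qed
  have eq: "?R = bump t0 \<alpha> \<tau> s
      + (- 4 * \<alpha> * \<tau> / s + \<alpha>\<^sup>2 * (4 * \<tau> ^ 3 / s + 52 * \<beta> * \<tau> / s\<^sup>2)) * p * k
      + \<alpha> * (4 * (\<beta> * \<bar>\<tau>\<bar>) + v / 4 - \<alpha> * (\<beta> * \<tau>\<^sup>2)) / s\<^sup>2 * k - \<alpha> / (2 * s\<^sup>2) * (p * k)\<^sup>2"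
  proof -
    have *: "1 - 2 * \<alpha> * (A + D - (2 * B + V) * w + q) + \<alpha>\<^sup>2 * (H + n - C * w)
      = 1 - 2 * \<alpha> * A + \<alpha>\<^sup>2 * H + (- 2 * \<alpha> * D + \<alpha>\<^sup>2 * n)
        + \<alpha> * (4 * B + 2 * V - \<alpha> * C) * w - 2 * \<alpha> * q" for A B C D H n w q V :: real
      by algebra
    have e0: "v / 4 = 2 * (v / 8)" by simp
    have e1: "(- 4 * \<alpha> * \<tau> / s + \<alpha>\<^sup>2 * n) * p * k = - 2 * \<alpha> * (2 * \<tau> / s * p * k) + \<alpha>\<^sup>2 * (n * p * k)" for n
      by (simp add: ring_distribs)
    have e2: "E / s\<^sup>2 * k = E * (k / s\<^sup>2)" for E by simp
    have e3: "\<alpha> / (2 * s\<^sup>2) * (p * k)\<^sup>2 = 2 * \<alpha> * ((p * k)\<^sup>2 / (4 * s\<^sup>2))" by simp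
    show ?thesis
      unfolding bump_def v_def[symmetric] e0 e1 e2 e3 by (rule *)
  qed
  show "bump t0 \<alpha> (\<tau> + k * p / (s + k)) (s + k) \<le> bump t0 \<alpha> \<tau> s
      + (- 4 * \<alpha> * \<tau> / s + \<alpha>\<^sup>2 * (4 * \<tau> ^ 3 / s + 52 * \<beta> * \<tau> / s\<^sup>2)) * p * k
      + \<alpha> * (4 * (\<beta> * \<bar>\<tau>\<bar>) + m * t0 * (1 - t0) / 4 - \<alpha> * (\<beta> * \<tau>\<^sup>2)) / s\<^sup>2 * k
      - \<alpha> / (2 * s\<^sup>2) * (p * k)\<^sup>2"
    using le unfolding eq unfolding \<tau>'_def v_def .
next
  show "0 < \<beta>" "0 \<le> t0" "t0 \<le> 1" using t0 \<beta>_pos by simp_all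
qed

text \<open>This function tends to infinity as \<open>x / (x + y)\<close> tends to 0: the proportion does not converge
  to 0, even from states with small \<open>x\<close>, where the summand \<open>\<beta> / x\<close> is needed.\<close>

lemma superharmonic_log_left:
  assumes "0 < R"
  shows "superharmonic R (\<lambda>x y. ln ((x + y) / x) + \<beta> / x)"
proof (rule superharmonicI)
  fix x y :: real assume xy: "0 < x" "0 < y" "R \<le> x + y"
  then show "continuous_on {0..\<beta>} (\<lambda>k. ln ((x + k + y) / (x + k)) + \<beta> / (x + k)) \<and>
      continuous_on {0..\<beta>} (\<lambda>k. ln ((x + (y + k)) / x) + \<beta> / x)"
    by (auto intro!: continuous_intros)
  define s where "s = x + y"
  have s: "0 < s" using xy by (simp add: s_def)
  have ln_s: "ln (s + k) \<le> ln s + k / s" if "0 \<le> k" for k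
  proof -
    have "ln (s + k) - ln s \<le> (s + k - s) / s" using s that by (intro ln_diff_le) auto
    then show ?thesis by simp
  qed
  have "ln ((x + k + y) / (x + k)) + \<beta> / (x + k)
      \<le> (1 / s - 1 / x) * k + (ln ((x + y) / x) + \<beta> / x + 0)" if k: "0 \<le> k" "k \<le> \<beta>" for k
  proof -
    have "ln x - ln (x + k) \<le> (x - (x + k)) / (x + k)"
      using xy k by (intro ln_diff_le) auto
    \<comment> \<open>After clearing denominators this is \<open>k * k \<le> \<beta> * k\<close>.
      The decrease of \<open>\<beta> / x\<close> thus absorbs the second-order error of the
      logarithm.\<close>
    moreover have "k / x + \<beta> / (x + k) \<le> k / (x + k) + \<beta> / x"
    proof -
      have "k / x + \<beta> / (x + k) = (k * (x + k) + \<beta> * x) / (x * (x + k))"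
        using xy k by (simp add: field_simps)
      also have "\<dots> \<le> (k * x + \<beta> * (x + k)) / (x * (x + k))"
        using xy k by (intro divide_right_mono) (auto simp: algebra_simps mult_right_mono)
      also have "\<dots> = k / (x + k) + \<beta> / x"
        using xy k by (simp add: field_simps)
      finally show ?thesis .
    qed
    moreover have "ln ((x + k + y) / (x + k)) = ln (s + k) - ln (x + k)"
      using xy k by (simp add: ln_div s_def add_ac)
    moreover have "ln ((x + y) / x) = ln s - ln x"
      using xy by (simp add: ln_div s_def)
    ultimately show ?thesis using ln_s[OF k(1)] by (simp add: left_diff_distrib)
  qed
  moreover have "ln ((x + (y + k)) / x) + \<beta> / x
      \<le> 1 / s * k + (ln ((x + y) / x) + \<beta> / x + 0)" if k: "0 \<le> k" "k \<le> \<beta>" for k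
    using ln_s[OF k(1)] xy k by (simp add: ln_div s_def add_ac)
  moreover have "x * ((1 / s - 1 / x) * m + 0) + y * (1 / s * m + 0) \<le> 0"
  proof -
    have "x * ((1 / s - 1 / x) * m + 0) + y * (1 / s * m + 0) = (x + y) / s * m - x / x * m"
      by (simp add: algebra_simps add_divide_distrib)
    then show ?thesis using xy by (simp add: s_def)
  qed
  ultimately show "\<exists>a c a' c'.
      (\<forall>k. 0 \<le> k \<longrightarrow> k \<le> \<beta> \<longrightarrow> ln ((x + k + y) / (x + k)) + \<beta> / (x + k)
        \<le> a * k + (ln ((x + y) / x) + \<beta> / x + c)) \<and>
      (\<forall>k. 0 \<le> k \<longrightarrow> k \<le> \<beta> \<longrightarrow> ln ((x + (y + k)) / x) + \<beta> / x
        \<le> a' * k + (ln ((x + y) / x) + \<beta> / x + c')) \<and>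
      x * (a * m + c) + y * (a' * m + c') \<le> 0"
    by blast
qed

lemma urn_swap: "urn \<beta> m Q P"
  by (intro urn.intro prob sets_eq mean m_pos)

lemma superharmonic_swap:
  assumes "urn.superharmonic Q P R h"
  shows "superharmonic R (\<lambda>x y. h y x)"
  unfolding superharmonic_def
proof (intro allI impI)
  fix x y :: real assume "0 < x" "0 < y" "R \<le> x + y"
  then show "integrable P (\<lambda>k. h y (x + k)) \<and> integrable Q (\<lambda>k. h (y + k) x) \<and>
      x * (\<integral>k. h y (x + k) \<partial>P) + y * (\<integral>k. h (y + k) x \<partial>Q) \<le> (x + y) * h y x"
    using assms[unfolded urn.superharmonic_def[OF urn_swap], rule_format, of y x]
    by (simp add: add.commute)
qed

lemma superharmonic_log_right:
  assumes "0 < R"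
  shows "superharmonic R (\<lambda>x y. ln ((x + y) / y) + \<beta> / y)"
  using superharmonic_swap[OF urn.superharmonic_log_left[OF urn_swap assms]]
  by (simp add: add.commute)

section \<open>Absence of atoms and full support\<close>

text \<open>The terms in \<open>\<tau>\<^sup>2\<close> and \<open>\<tau> ^ 4\<close> form a square,
  the corrections of the quartic part are nonnegative, and what remains vanishes as \<open>s\<close>
  grows.\<close>

lemma bump_ge:
  assumes "0 < s"
  shows "(1 - \<alpha> * \<tau>\<^sup>2)\<^sup>2 - 2 * \<alpha> * (m * t0 * (1 - t0) / 8) / s \<le> bump t0 \<alpha> \<tau> s"
proof -
  have "0 \<le> \<alpha>\<^sup>2 * (26 * \<beta> * \<tau>\<^sup>2 / s + 266 * \<beta>\<^sup>2 / s\<^sup>2)"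
    using assms \<beta>_pos by auto
  also have "\<dots> = bump t0 \<alpha> \<tau> s - ((1 - \<alpha> * \<tau>\<^sup>2)\<^sup>2 - 2 * \<alpha> * (m * t0 * (1 - t0) / 8 / s))"
    unfolding bump_def
    by (simp add: power2_eq_square power4_eq_xxxx algebra_simps)
  finally show ?thesis by simp
qed

text \<open>With \<open>\<alpha>\<close> of order \<open>s / (1 + s \<tau>\<^sup>2)\<close> the bump lives on the scale \<open>1 / sqrt s\<close> of the
  fluctuations of the limiting proportion, so that its value stays away from 1 uniformly in the state.\<close>

lemma bump_le:
  fixes B c \<tau> s :: real
  assumes c: "0 < c" "c \<le> 1" "c \<le> m * t0 * (1 - t0) / 8"
    and B: "B = 1 + 26 * \<beta> + 266 * \<beta>\<^sup>2" and s: "0 < s"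
  shows "bump t0 (c * s / (B * (1 + s * \<tau>\<^sup>2))) \<tau> s \<le> 1 - c\<^sup>2 / B"
proof -
  \<comment> \<open>With \<open>\<alpha> = a * s\<close> the bump depends on the state only through
    \<open>q\<close>. The choice \<open>a * (1 + q) = c / B\<close> minimises
    \<open>1 - 2 * c * X + B * X\<^sup>2\<close> over \<open>X\<close>.\<close>
  define q where "q = s * \<tau>\<^sup>2"
  have q: "0 \<le> q" using s by (simp add: q_def)
  define a where "a = c / (B * (1 + q))"
  have B_pos: "0 < B" unfolding B using \<beta>_pos by (intro add_pos_nonneg) auto
  have a: "0 < a" using c q B_pos by (simp add: a_def)
  have aq: "a * (1 + q) = c / B" using q B_pos by (simp add: a_def)
  define v where "v = m * t0 * (1 - t0) / 8"
  have \<alpha>: "c * s / (B * (1 + s * \<tau>\<^sup>2)) = a * s" by (simp add: a_def q_def)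
  have "bump t0 (a * s) \<tau> s = 1 - 2 * a * (q + v) + a\<^sup>2 * (q\<^sup>2 + 26 * \<beta> * q + 266 * \<beta>\<^sup>2)"
  proof -
    have "2 * (a * s) * (\<tau>\<^sup>2 + v / s) = 2 * a * (q + v)"
      using s by (simp add: q_def field_simps)
    moreover have "(a * s)\<^sup>2 * (\<tau> ^ 4 + 26 * \<beta> * \<tau>\<^sup>2 / s + 266 * \<beta>\<^sup>2 / s\<^sup>2)
        = a\<^sup>2 * (q\<^sup>2 + 26 * \<beta> * q + 266 * \<beta>\<^sup>2)"
      using s by (simp add: q_def field_simps power2_eq_square power4_eq_xxxx)
    ultimately show ?thesis unfolding bump_def v_def by simp
  qed
  also have "\<dots> \<le> 1 - 2 * a * (c * (1 + q)) + a\<^sup>2 * (B * (1 + q)\<^sup>2)"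
  proof -
    have "c * (1 + q) \<le> q + v"
      using c(3) mult_right_mono[OF c(2) q] unfolding v_def distrib_left by simp
    moreover have "q\<^sup>2 + 26 * \<beta> * q + 266 * \<beta>\<^sup>2 \<le> B * (1 + q)\<^sup>2"
    proof -
      have "0 \<le> 1 + 2 * q + (26 * \<beta> * (1 + q + q\<^sup>2)) + 266 * \<beta>\<^sup>2 * (2 * q + q\<^sup>2)"
        using q \<beta>_pos by (intro add_nonneg_nonneg mult_nonneg_nonneg) auto
      also have "\<dots> = B * (1 + q)\<^sup>2 - (q\<^sup>2 + 26 * \<beta> * q + 266 * \<beta>\<^sup>2)"
        unfolding B by (simp add: power2_eq_square algebra_simps)
      finally show ?thesis by simp
    qed
    ultimately show ?thesis
      using a by (intro add_mono diff_mono mult_left_mono) auto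
  qed
  also have "\<dots> = 1 - 2 * (a * (1 + q)) * c + (a * (1 + q))\<^sup>2 * B"
    by (simp add: power2_eq_square algebra_simps)
  also have "\<dots> = 1 - c\<^sup>2 / B"
    unfolding aq using B_pos by (simp add: power2_eq_square field_simps)
  finally show ?thesis unfolding \<alpha> .
qed

text \<open>A bound on the upper limit of \<open>u\<close> in a whole cone about the ray. Such
  bounds can be patched together by compactness of intervals of proportions.\<close>

definition eventually_le :: "(real \<Rightarrow> real \<Rightarrow> real) \<Rightarrow> real \<Rightarrow> real \<Rightarrow> bool" where
  "eventually_le u t0 K \<longleftrightarrow> (\<exists>\<rho>>0. \<exists>R. \<forall>x>0. \<forall>y>0. R \<le> x + y \<longrightarrow> \<bar>x / (x + y) - t0\<bar> \<le> \<rho> \<longrightarrow> u x y \<le> K)"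

lemma eventually_le_mono: "eventually_le u t0 K \<Longrightarrow> K \<le> K' \<Longrightarrow> eventually_le u t0 K'"
  unfolding eventually_le_def by (meson order_trans)

text \<open>The ray itself is excluded, since the boundary datum may have an atom there. The order
  of the quantifiers matters: one \<rho> serves all \<eta>, while \<open>R\<close> may grow as the
  excluded cone shrinks.\<close>

definition vanishes_around :: "(real \<Rightarrow> real \<Rightarrow> real) \<Rightarrow> real \<Rightarrow> bool" where
  "vanishes_around u t0 \<longleftrightarrow> (\<forall>\<epsilon>>0. \<exists>\<rho>>0. \<forall>\<eta>>0. \<exists>R. \<forall>x>0. \<forall>y>0. R \<le> x + y \<longrightarrow>
     \<eta> \<le> \<bar>x / (x + y) - t0\<bar> \<longrightarrow> \<bar>x / (x + y) - t0\<bar> \<le> \<rho> \<longrightarrow> u x y \<le> \<epsilon>)"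

text \<open>Close to the ray, \<open>u\<close> is at most \<open>K\<close> times a bump, up to errors, and the bump, adapted to the
  starting state, is there at most \<open>1 - c\<^sup>2 / B\<close>.\<close>

lemma eventually_le_contraction:
  assumes u: "superharmonic 0 (\<lambda>x y. - u x y)"
    and u_le: "\<And>x y. 0 < x \<Longrightarrow> 0 < y \<Longrightarrow> u x y \<le> 1"
    and t0: "0 < t0" "t0 < 1"
    and around: "vanishes_around u t0"
    and c: "c = min 1 (m * t0 * (1 - t0) / 8)" and B: "B = 1 + 26 * \<beta> + 266 * \<beta>\<^sup>2"
    and K: "eventually_le u t0 K" "0 \<le> K" and \<epsilon>: "0 < \<epsilon>"
  shows "eventually_le u t0 (K * (1 - c\<^sup>2 / B) + 2 * \<epsilon>)"
proof -
  define v where "v = m * t0 * (1 - t0)"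
  have v: "0 < v" using t0 m_pos by (simp add: v_def)
  have c': "0 < c" "c \<le> 1" "c \<le> v / 8" using v unfolding c v_def by auto
  have B_pos: "0 < B" unfolding B using \<beta>_pos by (intro add_pos_nonneg) auto
  obtain \<rho>1 R1 where 1: "0 < \<rho>1"
    "\<And>x y. 0 < x \<Longrightarrow> 0 < y \<Longrightarrow> R1 \<le> x + y \<Longrightarrow> \<bar>x / (x + y) - t0\<bar> \<le> \<rho>1 \<Longrightarrow> u x y \<le> K"
    using K(1) unfolding eventually_le_def by blast
  obtain \<rho>2 where 2: "0 < \<rho>2"
    "\<And>\<eta>. 0 < \<eta> \<Longrightarrow> \<exists>R. \<forall>x>0. \<forall>y>0. R \<le> x + y \<longrightarrow> \<eta> \<le> \<bar>x / (x + y) - t0\<bar> \<longrightarrow>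
      \<bar>x / (x + y) - t0\<bar> \<le> \<rho>2 \<longrightarrow> u x y \<le> \<epsilon>"
    using around \<epsilon> unfolding vanishes_around_def by blast
  define \<rho> where "\<rho> = min \<rho>1 \<rho>2"
  have \<rho>: "0 < \<rho>" "\<rho> \<le> \<rho>1" "\<rho> \<le> \<rho>2" using 1(1) 2(1) by (auto simp: \<rho>_def)
  \<comment> \<open>The smallest parameter that \<open>superharmonic_bump\<close> admits.\<close>
  define A where "A = 25 * \<beta> / v"
  have A: "0 < A" using v \<beta>_pos by (simp add: A_def)
  \<comment> \<open>In \<rho>3 and \<open>R3\<close>, the bounds containing \<open>A\<close> ensure
    \<open>A \<le> \<alpha>\<close> for the parameter chosen below, and those containing \<rho> keep
    the distance term at the starting state below \<epsilon>.\<close>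
  define \<rho>3 where "\<rho>3 = min (min 1 (c / (2 * B * A))) (\<rho> * min 1 (\<epsilon> / 2))"
  have \<rho>3: "0 < \<rho>3" using \<rho> \<epsilon> c' B_pos A by (simp add: \<rho>3_def)
  define R3 where "R3 = max (max \<beta> (2 * B * A / c)) (12 * \<beta> / (\<rho>\<^sup>2 * \<epsilon>))"
  have "u x1 y1 \<le> K * (1 - c\<^sup>2 / B) + 2 * \<epsilon>"
    if xy1: "0 < x1" "0 < y1" and R3: "R3 \<le> x1 + y1" and close: "\<bar>x1 / (x1 + y1) - t0\<bar> \<le> \<rho>3" for x1 y1
  proof -
    define s1 \<tau>1 where "s1 = x1 + y1" and "\<tau>1 = x1 / (x1 + y1) - t0"
    have s1: "0 < s1" "\<beta> \<le> s1" "2 * B * A / c \<le> s1" "12 * \<beta> / (\<rho>\<^sup>2 * \<epsilon>) \<le> s1"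
      using R3 xy1 by (auto simp: s1_def R3_def)
    have \<tau>1: "\<bar>\<tau>1\<bar> \<le> 1" "\<bar>\<tau>1\<bar> \<le> c / (2 * B * A)" "\<bar>\<tau>1\<bar> \<le> \<rho> * min 1 (\<epsilon> / 2)"
      using close by (auto simp: \<tau>1_def \<rho>3_def)
    have \<tau>1_sq: "\<tau>1\<^sup>2 \<le> c / (2 * B * A)"
    proof -
      have "\<bar>\<tau>1\<bar> * \<bar>\<tau>1\<bar> \<le> 1 * (c / (2 * B * A))"
        using \<tau>1 by (intro mult_mono) auto
      then show ?thesis by (simp add: power2_eq_square)
    qed
    define \<alpha> where "\<alpha> = c * s1 / (B * (1 + s1 * \<tau>1\<^sup>2))"
    have den: "0 < B * (1 + s1 * \<tau>1\<^sup>2)"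
      using B_pos s1 by (intro mult_pos_pos add_pos_nonneg) auto
    have "A \<le> \<alpha>"
    proof -
      have "A * (B * (1 + s1 * \<tau>1\<^sup>2)) = B * A + B * A * s1 * \<tau>1\<^sup>2"
        by (simp add: algebra_simps)
      also have "\<dots> \<le> c * s1 / 2 + B * A * s1 * (c / (2 * B * A))"
        using s1 c' A B_pos \<tau>1_sq
        by (intro add_mono mult_left_mono) (auto simp: field_simps)
      also have "\<dots> = c * s1" using A B_pos by (simp add: field_simps)
      finally show ?thesis unfolding \<alpha>_def using den by (simp add: pos_le_divide_eq)
    qed
    then have \<alpha>: "0 < \<alpha>" "25 * \<beta> \<le> \<alpha> * v"
      using A v by (linarith, simp add: A_def pos_divide_le_eq)
    \<comment> \<open>The summands beat \<open>u\<close> in three regions far out: beyond \<rho> the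
      distance term is at least 1, between \<eta> and \<rho> the bound \<epsilon> suffices, and
      within \<eta> of the ray \<open>u \<le> K\<close> while the bump is almost at least 1.\<close>
    define h where "h x y = K * bump t0 \<alpha> (x / (x + y) - t0) (x + y)
      + (\<epsilon> + (1 / \<rho>\<^sup>2 * ((x / (x + y) - t0)\<^sup>2 + 6 * \<beta> / (x + y)) + (- u x y)))" for x y
    have h: "superharmonic \<beta> h"
      unfolding h_def using t0 \<alpha> K(2) \<beta>_pos
      by (intro superharmonic_add superharmonic_cmult superharmonic_const superharmonic_bump
          superharmonic_distance superharmonic_antimono[OF u]) (auto simp: v_def)
    have Kbump: "K * (1 - 2 * \<alpha> * \<tau>\<^sup>2) - K * \<alpha> * v / 4 / s \<le> K * bump t0 \<alpha> \<tau> s"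
      "- (K * \<alpha> * v / 4 / s) \<le> K * bump t0 \<alpha> \<tau> s" if "0 < s" for \<tau> s
    proof -
      have ge: "K * ((1 - \<alpha> * \<tau>\<^sup>2)\<^sup>2 - 2 * \<alpha> * (v / 8) / s) \<le> K * bump t0 \<alpha> \<tau> s"
        using bump_ge[OF that, of \<alpha> \<tau> t0] K(2) by (intro mult_left_mono) (auto simp: v_def)
      have eq: "K * (q - 2 * \<alpha> * (v / 8) / s) = K * q - K * \<alpha> * v / 4 / s" for q
        by (simp add: algebra_simps)
      have "(1 - \<alpha> * \<tau>\<^sup>2)\<^sup>2 = 1 - 2 * \<alpha> * \<tau>\<^sup>2 + (\<alpha> * \<tau>\<^sup>2)\<^sup>2"
        by (simp add: power2_diff)
      then have "1 - 2 * \<alpha> * \<tau>\<^sup>2 \<le> (1 - \<alpha> * \<tau>\<^sup>2)\<^sup>2"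
        by simp
      then have "K * (1 - 2 * \<alpha> * \<tau>\<^sup>2) \<le> K * (1 - \<alpha> * \<tau>\<^sup>2)\<^sup>2" "0 \<le> K * (1 - \<alpha> * \<tau>\<^sup>2)\<^sup>2"
        using K(2) by (auto intro: mult_left_mono)
      with ge show "K * (1 - 2 * \<alpha> * \<tau>\<^sup>2) - K * \<alpha> * v / 4 / s \<le> K * bump t0 \<alpha> \<tau> s"
        "- (K * \<alpha> * v / 4 / s) \<le> K * bump t0 \<alpha> \<tau> s"
        unfolding eq by linarith+
    qed
    have dist_nonneg: "0 \<le> 1 / \<rho>\<^sup>2 * (\<tau>\<^sup>2 + 6 * \<beta> / s)" if "0 < s" for \<tau> s
      using that \<beta>_pos by auto
    have "0 \<le> h x1 y1"
    proof (rule minimum_principle[OF h])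
      show "0 \<le> \<beta>" "\<beta> \<le> x1 + y1" using \<beta>_pos s1 by (auto simp: s1_def)
      fix x y :: real assume xy: "0 < x" "0 < y" "\<beta> \<le> x + y"
      have s: "0 < x + y" using xy by simp
      have "K * \<alpha> * v / 4 / (x + y) \<le> K * \<alpha> * v / 4 / \<beta>"
        using xy K(2) \<alpha> v \<beta>_pos by (intro divide_left_mono) auto
      then show "- (K * \<alpha> * v / 4 / \<beta> + 1) \<le> h x y"
        using Kbump(2)[OF s, of "x / (x + y) - t0"] dist_nonneg[OF s, of "x / (x + y) - t0"]
          u_le[OF xy(1,2)] \<epsilon>
        unfolding h_def by linarith
    next
      fix \<delta> :: real assume \<delta>: "0 < \<delta>"
      \<comment> \<open>\<alpha> depends only on the starting state, so \<eta> may depend on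
        \<alpha>. Within \<eta> of the ray the loss \<open>2 * K * \<alpha> * \<tau>\<^sup>2\<close>
        is then at most \<open>\<delta> / 2\<close>.\<close>
      define \<eta> where "\<eta> = min 1 (\<delta> / (4 * K * \<alpha> + 1))"
      have Ka: "0 \<le> K * \<alpha>" using K(2) \<alpha> by simp
      have \<eta>: "0 < \<eta>" "\<eta> \<le> 1" "2 * (K * \<alpha>) * \<eta> \<le> \<delta> / 2"
      proof -
        show "0 < \<eta>" using \<delta> Ka by (auto simp: \<eta>_def)
        show "\<eta> \<le> 1" by (simp add: \<eta>_def)
        have "(4 * (K * \<alpha>) + 1) * \<eta> \<le> (4 * (K * \<alpha>) + 1) * (\<delta> / (4 * (K * \<alpha>) + 1))"
          using Ka by (intro mult_left_mono) (auto simp: \<eta>_def mult.assoc)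
        also have "\<dots> = \<delta>" using Ka by simp
        finally show "2 * (K * \<alpha>) * \<eta> \<le> \<delta> / 2" using \<open>0 < \<eta>\<close> by (simp add: algebra_simps)
      qed
      obtain R where R: "\<And>x y. 0 < x \<Longrightarrow> 0 < y \<Longrightarrow> R \<le> x + y \<Longrightarrow> \<eta> \<le> \<bar>x / (x + y) - t0\<bar> \<Longrightarrow>
          \<bar>x / (x + y) - t0\<bar> \<le> \<rho>2 \<Longrightarrow> u x y \<le> \<epsilon>"
        using 2(2)[OF \<eta>(1)] by blast
      show "\<exists>S. \<forall>x>0. \<forall>y>0. S \<le> x + y \<longrightarrow> - \<delta> \<le> h x y"
      proof (intro exI allI impI)
        fix x y :: real
        assume xy: "0 < x" "0 < y" and S: "max (max R R1) (K * \<alpha> * v / (2 * \<delta>)) \<le> x + y"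
        define s \<tau> where "s = x + y" and "\<tau> = x / (x + y) - t0"
        have s: "0 < s" using xy by (simp add: s_def)
        have "K * \<alpha> * v / (2 * \<delta>) \<le> s" using S by (simp add: s_def)
        then have small: "K * \<alpha> * v / 4 / s \<le> \<delta> / 2"
          using s \<delta> by (simp add: field_simps)
        have h_eq: "h x y = K * bump t0 \<alpha> \<tau> s + (\<epsilon> + (1 / \<rho>\<^sup>2 * (\<tau>\<^sup>2 + 6 * \<beta> / s) + (- u x y)))"
          by (simp add: h_def s_def \<tau>_def)
        note b = Kbump[OF s, of \<tau>] dist_nonneg[OF s, of \<tau>]
        consider "\<rho> \<le> \<bar>\<tau>\<bar>" | "\<eta> \<le> \<bar>\<tau>\<bar>" "\<bar>\<tau>\<bar> < \<rho>" | "\<bar>\<tau>\<bar> < \<eta>" "\<bar>\<tau>\<bar> < \<rho>" by linarith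
        then show "- \<delta> \<le> h x y"
        proof cases
          case 1
          then have "\<rho>\<^sup>2 \<le> \<tau>\<^sup>2" using \<rho> by (intro abs_le_square_iff[THEN iffD1]) auto
          then have "1 \<le> 1 / \<rho>\<^sup>2 * \<tau>\<^sup>2" using \<rho> by simp
          also have "\<dots> \<le> 1 / \<rho>\<^sup>2 * (\<tau>\<^sup>2 + 6 * \<beta> / s)"
            using s \<beta>_pos by (intro mult_left_mono) auto
          finally show ?thesis
            using u_le[OF xy] b small \<delta> \<epsilon> unfolding h_eq by linarith
        next
          case 2
          then have "u x y \<le> \<epsilon>" using R[OF xy] S \<rho> by (auto simp: \<tau>_def)
          then show ?thesis using b small \<delta> \<epsilon> unfolding h_eq by linarith
        next
          case 3
          then have u: "u x y \<le> K" using 1(2)[OF xy] S \<rho> by (auto simp: \<tau>_def)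
          have "\<bar>\<tau>\<bar> * \<bar>\<tau>\<bar> \<le> \<eta> * 1"
            using 3 \<eta> by (intro mult_mono) auto
          then have "2 * (K * \<alpha>) * \<tau>\<^sup>2 \<le> 2 * (K * \<alpha>) * \<eta>"
            using Ka by (intro mult_left_mono) (auto simp: power2_eq_square)
          moreover have "K * (1 - 2 * \<alpha> * \<tau>\<^sup>2) = K - 2 * (K * \<alpha>) * \<tau>\<^sup>2"
            by (simp add: algebra_simps)
          ultimately show ?thesis using u b small \<delta> \<epsilon> \<eta>(3) unfolding h_eq by linarith
        qed
      qed
    qed (use xy1 in auto)
    then have "u x1 y1 \<le> K * bump t0 \<alpha> \<tau>1 s1 + \<epsilon> + 1 / \<rho>\<^sup>2 * (\<tau>1\<^sup>2 + 6 * \<beta> / s1)"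
      by (simp add: h_def s1_def \<tau>1_def)
    also have "\<dots> \<le> K * (1 - c\<^sup>2 / B) + \<epsilon> + \<epsilon>"
    proof (intro add_mono mult_left_mono K(2) order_refl)
      show "bump t0 \<alpha> \<tau>1 s1 \<le> 1 - c\<^sup>2 / B"
        unfolding \<alpha>_def using c' s1 B by (intro bump_le) (auto simp: v_def)
      have "\<bar>\<tau>1\<bar> * \<bar>\<tau>1\<bar> \<le> (\<rho> * 1) * (\<rho> * (\<epsilon> / 2))"
        using \<tau>1(3) \<rho> \<epsilon> by (intro mult_mono order_trans[OF \<tau>1(3)] mult_left_mono) auto
      then have "1 / \<rho>\<^sup>2 * \<tau>1\<^sup>2 \<le> \<epsilon> / 2"
        using \<rho> by (simp add: field_simps power2_eq_square)
      moreover have "1 / \<rho>\<^sup>2 * (6 * \<beta> / s1) \<le> \<epsilon> / 2"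
        using s1 \<rho> \<epsilon> by (simp add: field_simps)
      ultimately show "1 / \<rho>\<^sup>2 * (\<tau>1\<^sup>2 + 6 * \<beta> / s1) \<le> \<epsilon>"
        unfolding distrib_left by linarith
    qed
    finally show ?thesis by simp
  qed
  then show ?thesis unfolding eventually_le_def using \<rho>3 by blast
qed

text \<open>The contraction is iterated from the trivial bound. With error
  \<open>2 * (\<kappa> * \<delta> / 4)\<close> in each round its fixed point is
  \<open>\<delta> / 2\<close>, and the distance to it shrinks by the factor
  \<open>1 - \<kappa>\<close>.\<close>

lemma eventually_le_of_vanishes_around:
  assumes u: "superharmonic 0 (\<lambda>x y. - u x y)"
    and u_le: "\<And>x y. 0 < x \<Longrightarrow> 0 < y \<Longrightarrow> u x y \<le> 1"
    and t0: "0 < t0" "t0 < 1"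
    and around: "vanishes_around u t0" and \<delta>: "0 < \<delta>"
  shows "eventually_le u t0 \<delta>"
proof -
  define c B \<kappa> where "c = min 1 (m * t0 * (1 - t0) / 8)"
    and "B = 1 + 26 * \<beta> + 266 * \<beta>\<^sup>2" and "\<kappa> = c\<^sup>2 / B"
  have c: "0 < c" "c \<le> 1" using t0 m_pos by (auto simp: c_def)
  have B: "1 \<le> B" using \<beta>_pos by (simp add: B_def)
  have "c\<^sup>2 \<le> 1" using c by (simp add: power_le_one)
  then have "c\<^sup>2 / B \<le> 1" using B by (simp add: divide_le_eq)
  then have \<kappa>: "0 < \<kappa>" "\<kappa> \<le> 1" using c B by (auto simp: \<kappa>_def)
  have iter: "eventually_le u t0 (\<delta> / 2 + (1 - \<kappa>) ^ n)" for n
  proof (induction n)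
    case 0
    have "u x y \<le> \<delta> / 2 + 1" if "0 < x" "0 < y" for x y
      using u_le[OF that] \<delta> by simp
    then show ?case unfolding eventually_le_def by (auto intro!: exI[of _ 1])
  next
    case (Suc n)
    have "0 \<le> \<delta> / 2 + (1 - \<kappa>) ^ n" using \<delta> \<kappa> by simp
    then have "eventually_le u t0 ((\<delta> / 2 + (1 - \<kappa>) ^ n) * (1 - c\<^sup>2 / B) + 2 * (\<kappa> * \<delta> / 4))"
      using \<kappa> \<delta> by (intro eventually_le_contraction u u_le t0 around c_def B_def Suc) auto
    moreover have "(\<delta> / 2 + (1 - \<kappa>) ^ n) * (1 - c\<^sup>2 / B) + 2 * (\<kappa> * \<delta> / 4)
        = \<delta> / 2 + (1 - \<kappa>) ^ Suc n"
      unfolding \<kappa>_def[symmetric] by (simp add: field_simps)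
    ultimately show ?case by simp
  qed
  obtain n where "(1 - \<kappa>) ^ n < \<delta> / 2"
    using real_arch_pow_inv[of "\<delta> / 2" "1 - \<kappa>"] \<delta> \<kappa> by auto
  then show ?thesis using eventually_le_mono[OF iter[of n]] by simp
qed

lemma eventually_le_compact:
  assumes int: "\<And>t. 0 < t \<Longrightarrow> t < 1 \<Longrightarrow> eventually_le u t \<epsilon>" and \<eta>: "0 < \<eta>"
  shows "\<exists>R. \<forall>x>0. \<forall>y>0. R \<le> x + y \<longrightarrow> \<eta> \<le> x / (x + y) \<longrightarrow> x / (x + y) \<le> 1 - \<eta> \<longrightarrow> u x y \<le> \<epsilon>"
proof -
  have "\<exists>\<rho> R. 0 < \<rho> \<and> (\<forall>x>0. \<forall>y>0. R \<le> x + y \<longrightarrow> \<bar>x / (x + y) - t\<bar> \<le> \<rho> \<longrightarrow> u x y \<le> \<epsilon>)"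
    if "t \<in> {\<eta>..1 - \<eta>}" for t
    using int[of t] that \<eta> unfolding eventually_le_def by auto
  then obtain \<rho> R where \<rho>: "\<And>t. t \<in> {\<eta>..1 - \<eta>} \<Longrightarrow> 0 < \<rho> t"
    and R: "\<And>t x y. t \<in> {\<eta>..1 - \<eta>} \<Longrightarrow> 0 < x \<Longrightarrow> 0 < y \<Longrightarrow> R t \<le> x + y \<Longrightarrow>
      \<bar>x / (x + y) - t\<bar> \<le> \<rho> t \<Longrightarrow> u x y \<le> \<epsilon>"
    by metis
  have "{\<eta>..1 - \<eta>} \<subseteq> (\<Union>t\<in>{\<eta>..1 - \<eta>}. ball t (\<rho> t))"
    using \<rho> by force
  then obtain C where C: "C \<subseteq> {\<eta>..1 - \<eta>}" "finite C"
    "{\<eta>..1 - \<eta>} \<subseteq> (\<Union>t\<in>C. ball t (\<rho> t))"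
    using compactE_image[OF compact_Icc, of "{\<eta>..1 - \<eta>}" "\<lambda>t. ball t (\<rho> t)"] by (metis open_ball)
  \<comment> \<open>The 0 keeps \<open>Max\<close> meaningful when the interval, and with it
    \<open>C\<close>, is empty.\<close>
  define S where "S = Max (insert 0 (R ` C))"
  show ?thesis
  proof (intro exI allI impI)
    fix x y :: real
    assume xy: "0 < x" "0 < y" "S \<le> x + y" "\<eta> \<le> x / (x + y)" "x / (x + y) \<le> 1 - \<eta>"
    then obtain t where t: "t \<in> C" "x / (x + y) \<in> ball t (\<rho> t)"
      using C(3) by force
    have "R t \<le> S" unfolding S_def using C t by (intro Max_ge) auto
    then show "u x y \<le> \<epsilon>"
      using t xy C(1) by (intro R[of t x y]) (auto simp: dist_real_def abs_minus_commute)
  qed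
qed

text \<open>Far out, \<open>u\<close> is at most \<epsilon> in every closed sector inside the
  quadrant, and near the axes \<delta> times the logarithmic function exceeds 1. That function is
  finite at \<open>(x0, y0)\<close>, so \<epsilon> and \<delta> can be sent to 0.\<close>

lemma vanishing:
  assumes u: "superharmonic 0 (\<lambda>x y. - u x y)"
    and u_le: "\<And>x y. 0 < x \<Longrightarrow> 0 < y \<Longrightarrow> u x y \<le> 1"
    and around: "\<And>t. 0 < t \<Longrightarrow> t < 1 \<Longrightarrow> vanishes_around u t"
    and xy0: "0 < x0" "0 < y0"
  shows "u x0 y0 \<le> 0"
proof -
  define g where "g x y = (ln ((x + y) / x) + \<beta> / x) + (ln ((x + y) / y) + \<beta> / y)" for x y
  have g_ge: "ln ((x + y) / x) \<le> g x y" "ln ((x + y) / y) \<le> g x y" "0 \<le> g x y"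
    if "0 < x" "0 < y" for x y
  proof -
    have "0 \<le> ln ((x + y) / x)" "0 \<le> ln ((x + y) / y)" "0 \<le> \<beta> / x" "0 \<le> \<beta> / y"
      using that \<beta>_pos by auto
    then show "ln ((x + y) / x) \<le> g x y" "ln ((x + y) / y) \<le> g x y" "0 \<le> g x y"
      unfolding g_def by linarith+
  qed
  have le: "u x0 y0 \<le> \<epsilon> + \<delta> * g x0 y0" if \<epsilon>: "0 < \<epsilon>" and \<delta>: "0 < \<delta>" for \<epsilon> \<delta>
  proof -
    define R0 where "R0 = x0 + y0"
    have R0: "0 < R0" using xy0 by (simp add: R0_def)
    define h where "h x y = \<epsilon> + (\<delta> * g x y + (- u x y))" for x y
    have "superharmonic R0 h"
      unfolding h_def g_def using \<delta> R0
      by (intro superharmonic_add superharmonic_const superharmonic_cmult superharmonic_log_left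
          superharmonic_log_right superharmonic_antimono[OF u]) auto
    then have "0 \<le> h x0 y0"
    proof (rule minimum_principle)
      show "0 \<le> R0" "R0 \<le> x0 + y0" using R0 by (auto simp: R0_def)
      fix x y :: real assume xy: "0 < x" "0 < y"
      have "0 \<le> \<delta> * g x y" using \<delta> g_ge(3)[OF xy] by simp
      then show "- 1 \<le> h x y" using u_le[OF xy] \<epsilon> unfolding h_def by linarith
    next
      fix \<delta>' :: real assume "0 < \<delta>'"
      \<comment> \<open>The proportion at which \<open>\<delta> * ln (1 / t)\<close> reaches
        1.\<close>
      define \<eta> where "\<eta> = exp (- 1 / \<delta>)"
      have big: "1 \<le> \<delta> * ln (1 / t)" if "0 < t" "t \<le> \<eta>" for t
      proof -
        have "ln t \<le> ln \<eta>" using that ln_le_cancel_iff[of t \<eta>] by (smt (verit))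
        then have "ln t \<le> - 1 / \<delta>" by (simp add: \<eta>_def)
        then show ?thesis using \<delta> that by (simp add: ln_div field_simps)
      qed
      have "eventually_le u t \<epsilon>" if "0 < t" "t < 1" for t
        using that u u_le around \<epsilon> by (intro eventually_le_of_vanishes_around) auto
      then obtain R where R: "\<And>x y. 0 < x \<Longrightarrow> 0 < y \<Longrightarrow> R \<le> x + y \<Longrightarrow> \<eta> \<le> x / (x + y) \<Longrightarrow>
          x / (x + y) \<le> 1 - \<eta> \<Longrightarrow> u x y \<le> \<epsilon>"
        using eventually_le_compact[of u \<epsilon> \<eta>] by (auto simp: \<eta>_def)
      show "\<exists>S. \<forall>x>0. \<forall>y>0. S \<le> x + y \<longrightarrow> - \<delta>' \<le> h x y"
      proof (intro exI allI impI)
        fix x y :: real assume xy: "0 < x" "0 < y" "R \<le> x + y"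
        have g: "\<delta> * ln ((x + y) / x) \<le> \<delta> * g x y" "\<delta> * ln ((x + y) / y) \<le> \<delta> * g x y"
          "0 \<le> \<delta> * g x y"
          using \<delta> g_ge[OF xy(1,2)] by auto
        have y: "y / (x + y) = 1 - x / (x + y)" using xy by (simp add: field_simps)
        consider "x / (x + y) \<le> \<eta>" | "y / (x + y) \<le> \<eta>"
          | "\<eta> \<le> x / (x + y)" "x / (x + y) \<le> 1 - \<eta>" unfolding y by linarith
        then have "u x y \<le> \<epsilon> + \<delta> * g x y"
        proof cases
          case 1
          then have "1 \<le> \<delta> * ln ((x + y) / x)" using big[of "x / (x + y)"] xy by simp
          then show ?thesis using u_le[OF xy(1,2)] g \<epsilon> by linarith
        next
          case 2
          then have "1 \<le> \<delta> * ln ((x + y) / y)" using big[of "y / (x + y)"] xy by simp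
          then show ?thesis using u_le[OF xy(1,2)] g \<epsilon> by linarith
        next
          case 3
          then show ?thesis using R[OF xy] g by linarith
        qed
        then show "- \<delta>' \<le> h x y" using \<open>0 < \<delta>'\<close> unfolding h_def by linarith
      qed
    qed (use xy0 in auto)
    then show ?thesis by (simp add: h_def)
  qed
  show ?thesis
  proof (rule field_le_epsilon)
    fix \<epsilon> :: real assume \<epsilon>: "0 < \<epsilon>"
    have g: "0 \<le> g x0 y0" using g_ge(3) xy0 by simp
    define G where "G = 1 + g x0 y0"
    have G: "0 < G" "g x0 y0 \<le> G" using g by (auto simp: G_def)
    have "\<epsilon> / 2 / G * g x0 y0 \<le> \<epsilon> / 2 / G * G"
      using \<epsilon> G by (intro mult_left_mono) auto
    also have "\<dots> = \<epsilon> / 2" using G by simp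
    finally show "u x0 y0 \<le> 0 + \<epsilon>"
      using le[of "\<epsilon> / 2" "\<epsilon> / 2 / G"] \<epsilon> G by auto
  qed
qed

text \<open>Chebyshev's inequality for the limiting proportion: \<open>c\<close> minus
  \<open>c / \<rho>\<^sup>2\<close> times the distance function is at most \<open>c\<close>
  everywhere and at most 0 once the proportion is \<rho> or more away from
  \<open>t0\<close>.\<close>

lemma interval_lower_bound:
  assumes v: "superharmonic 0 v" and v_ge: "\<And>x y. 0 < x \<Longrightarrow> 0 < y \<Longrightarrow> 0 \<le> v x y"
    and t0: "0 \<le> t0" "t0 \<le> 1" and \<rho>: "0 < \<rho>" and c: "0 \<le> c"
    and lim: "\<And>\<epsilon>. 0 < \<epsilon> \<Longrightarrow> \<exists>R. \<forall>x>0. \<forall>y>0. R \<le> x + y \<longrightarrow> \<bar>x / (x + y) - t0\<bar> \<le> \<rho> \<longrightarrow> c - \<epsilon> \<le> v x y"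
    and xy0: "0 < x0" "0 < y0" "\<beta> \<le> x0 + y0"
  shows "c * (1 - ((x0 / (x0 + y0) - t0)\<^sup>2 + 6 * \<beta> / (x0 + y0)) / \<rho>\<^sup>2) \<le> v x0 y0"
proof -
  define d where "d x y = (x / (x + y) - t0)\<^sup>2 + 6 * \<beta> / (x + y)" for x y
  define h where "h x y = v x y + (c / \<rho>\<^sup>2 * d x y + - c)" for x y
  have d: "0 \<le> c / \<rho>\<^sup>2 * d x y" if "0 < x" "0 < y" for x y
    unfolding d_def using that c \<beta>_pos by auto
  have "superharmonic \<beta> h"
    unfolding h_def d_def using t0 \<beta>_pos c
    by (intro superharmonic_add superharmonic_antimono[OF v] superharmonic_cmult
        superharmonic_distance superharmonic_const) auto
  then have "0 \<le> h x0 y0"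
  proof (rule minimum_principle)
    show "- c \<le> h x y" if "0 < x" "0 < y" for x y
      using v_ge[OF that] d[OF that] unfolding h_def by linarith
  next
    fix \<epsilon> :: real assume \<epsilon>: "0 < \<epsilon>"
    obtain R where R: "\<And>x y. 0 < x \<Longrightarrow> 0 < y \<Longrightarrow> R \<le> x + y \<Longrightarrow> \<bar>x / (x + y) - t0\<bar> \<le> \<rho> \<Longrightarrow> c - \<epsilon> \<le> v x y"
      using lim[OF \<epsilon>] by blast
    show "\<exists>S. \<forall>x>0. \<forall>y>0. S \<le> x + y \<longrightarrow> - \<epsilon> \<le> h x y"
    proof (intro exI allI impI)
      fix x y :: real assume xy: "0 < x" "0 < y" "R \<le> x + y"
      show "- \<epsilon> \<le> h x y"
      proof (cases "\<bar>x / (x + y) - t0\<bar> \<le> \<rho>")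
        case True
        then show ?thesis using R[OF xy] d[OF xy(1,2)] unfolding h_def by linarith
      next
        case False
        then have "\<rho>\<^sup>2 \<le> (x / (x + y) - t0)\<^sup>2" using \<rho> by (intro abs_le_square_iff[THEN iffD1]) auto
        also have "\<dots> \<le> d x y" using xy \<beta>_pos by (simp add: d_def)
        finally have "c / \<rho>\<^sup>2 * \<rho>\<^sup>2 \<le> c / \<rho>\<^sup>2 * d x y"
          using c by (intro mult_left_mono) auto
        then show ?thesis using \<rho> v_ge[OF xy(1,2)] \<epsilon> unfolding h_def by simp
      qed
    qed
  qed (use xy0 \<beta>_pos in auto)
  then have "c * (1 - d x0 y0 / \<rho>\<^sup>2) \<le> v x0 y0"
    unfolding h_def by (simp add: right_diff_distrib)
  then show ?thesis unfolding d_def .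
qed

text \<open>A nonnegative function with integral at most 0 vanishes almost everywhere. If it were
  positive at all steps of size at least \<open>m / 2\<close>, almost all steps would be shorter,
  against their mean \<open>m\<close>.\<close>

lemma large_step_null:
  fixes f :: "real \<Rightarrow> real"
  assumes N: "N = P \<or> N = Q" "integrable N f"
    and f: "\<And>k. 0 \<le> k \<Longrightarrow> k \<le> \<beta> \<Longrightarrow> 0 \<le> f k" "(\<integral>k. f k \<partial>N) \<le> 0"
  shows "\<exists>k. m / 2 \<le> k \<and> k \<le> \<beta> \<and> f k \<le> 0"
proof (rule ccontr)
  assume no: "\<not> ?thesis"
  have sp: "space N = {0..\<beta>}" using N space_eq by auto
  have ae: "AE k in N. 0 \<le> f k" using f(1) sp by (intro AE_I2) auto
  have "0 \<le> (\<integral>k. f k \<partial>N)" by (rule integral_nonneg_AE[OF ae])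
  with f(2) have "(\<integral>k. f k \<partial>N) = 0" by simp
  then have "AE k in N. f k = 0" using integral_nonneg_eq_0_iff_AE[OF N(2) ae] by simp
  then have "AE k in N. k \<le> m / 2"
  proof (rule AE_mp, intro AE_I2 impI)
    fix k assume "k \<in> space N" "f k = 0"
    then show "k \<le> m / 2" using no sp by (cases "m / 2 \<le> k") auto
  qed
  then have "(\<integral>k. k \<partial>N) \<le> (\<integral>k. 0 * k + m / 2 \<partial>N)"
    using N by (intro integral_mono_AE integrable_continuous continuous_intros) auto
  also have "\<dots> = m / 2" using integral_affine[OF N(1), of 0 "m / 2"] by simp
  finally show False using mean N m_pos by auto
qed

text \<open>From a zero of \<open>u\<close> one can always step by at least \<open>m / 2\<close> to another zero, in the \<open>x\<close>- as
  well as in the \<open>y\<close>-direction. Stepping towards the ray \<open>x / (x + y) = t0\<close> keeps the zeros at bounded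
  distance from that ray.\<close>

lemma positivity_spreads:
  assumes u: "superharmonic 0 u" and u_ge: "\<And>x y. 0 < x \<Longrightarrow> 0 < y \<Longrightarrow> 0 \<le> u x y"
    and t0: "0 \<le> t0" "t0 \<le> 1" and \<rho>: "0 < \<rho>"
    and pos: "\<And>x y. 0 < x \<Longrightarrow> 0 < y \<Longrightarrow> R \<le> x + y \<Longrightarrow> \<bar>x / (x + y) - t0\<bar> \<le> \<rho> \<Longrightarrow> 0 < u x y"
    and xy0: "0 < x0" "0 < y0"
  shows "0 < u x0 y0"
proof (rule ccontr)
  assume "\<not> 0 < u x0 y0"
  then have bad0: "u x0 y0 \<le> 0" by simp
  \<comment> \<open>\<open>e x y / (x + y)\<close> is the deviation of the proportion from
    \<open>t0\<close>. A step against the sign of \<open>e\<close> changes it by at most \<beta>, so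
    the bound \<open>E\<close> below is preserved along the chain while the sum grows.\<close>
  define e where "e x y = (1 - t0) * x - t0 * y" for x y
  have step: "(\<exists>k. m / 2 \<le> k \<and> k \<le> \<beta> \<and> u (x + k) y \<le> 0) \<and>
      (\<exists>k. m / 2 \<le> k \<and> k \<le> \<beta> \<and> u x (y + k) \<le> 0)"
    if xy: "0 < x" "0 < y" and bad: "u x y \<le> 0" for x y
  proof -
    have i: "integrable P (\<lambda>k. u (x + k) y)" "integrable Q (\<lambda>k. u x (y + k))"
      and le: "x * (\<integral>k. u (x + k) y \<partial>P) + y * (\<integral>k. u x (y + k) \<partial>Q) \<le> (x + y) * u x y"
      using u xy unfolding superharmonic_def by auto
    have le0: "(x + y) * u x y \<le> 0" using bad xy by (simp add: mult_le_0_iff)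
    have nn: "0 \<le> (\<integral>k. u (x + k) y \<partial>P)" "0 \<le> (\<integral>k. u x (y + k) \<partial>Q)"
      using xy u_ge space_eq by (auto intro!: Bochner_Integration.integral_nonneg)
    then have "0 \<le> x * (\<integral>k. u (x + k) y \<partial>P)" "0 \<le> y * (\<integral>k. u x (y + k) \<partial>Q)"
      using xy by auto
    with le le0 have "x * (\<integral>k. u (x + k) y \<partial>P) \<le> 0" "y * (\<integral>k. u x (y + k) \<partial>Q) \<le> 0"
      by linarith+
    then have "(\<integral>k. u (x + k) y \<partial>P) \<le> 0" "(\<integral>k. u x (y + k) \<partial>Q) \<le> 0"
      using xy by (auto simp: mult_le_0_iff)
    then show ?thesis
      using large_step_null[OF _ i(1)] large_step_null[OF _ i(2)] u_ge xy by simp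
  qed
  define E where "E = max \<bar>e x0 y0\<bar> \<beta>"
  have chain: "\<exists>x>0. \<exists>y>0. u x y \<le> 0 \<and> \<bar>e x y\<bar> \<le> E \<and> x0 + y0 + real n * (m / 2) \<le> x + y" for n
  proof (induction n)
    case 0
    then show ?case using xy0 bad0 by (intro exI[of _ x0] exI[of _ y0] conjI) (auto simp: E_def)
  next
    case (Suc n)
    then obtain x y where xy: "0 < x" "0 < y" "u x y \<le> 0" "\<bar>e x y\<bar> \<le> E"
      "x0 + y0 + real n * (m / 2) \<le> x + y" by blast
    have n: "real (Suc n) * (m / 2) = real n * (m / 2) + m / 2" by (simp add: algebra_simps add_divide_distrib)
    show ?case
    proof (cases "e x y \<le> 0")
      case True
      obtain k where k: "m / 2 \<le> k" "k \<le> \<beta>" "u (x + k) y \<le> 0" using step[OF xy(1-3)] by blast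
      have "e (x + k) y = e x y + (1 - t0) * k" by (simp add: e_def algebra_simps)
      moreover have "0 \<le> (1 - t0) * k" using k m_pos t0 by simp
      moreover have "(1 - t0) * k \<le> 1 * \<beta>" using k m_pos t0 by (intro mult_mono) auto
      ultimately have "\<bar>e (x + k) y\<bar> \<le> E" using True xy(4) by (auto simp: E_def)
      then show ?thesis using k xy m_pos n by (intro exI[of _ "x + k"] exI[of _ y] conjI) linarith+
    next
      case False
      obtain k where k: "m / 2 \<le> k" "k \<le> \<beta>" "u x (y + k) \<le> 0" using step[OF xy(1-3)] by blast
      have "e x (y + k) = e x y - t0 * k" by (simp add: e_def algebra_simps)
      moreover have "0 \<le> t0 * k" using k m_pos t0 by simp
      moreover have "t0 * k \<le> 1 * \<beta>" using k m_pos t0 by (intro mult_mono) auto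
      ultimately have "\<bar>e x (y + k)\<bar> \<le> E" using False xy(4) by (auto simp: E_def)
      then show ?thesis using k xy m_pos n by (intro exI[of _ x] exI[of _ "y + k"] conjI) linarith+
    qed
  qed
  obtain n :: nat where n: "max R (E / \<rho>) < real n * (m / 2)"
    using reals_Archimedean3[of "m / 2"] m_pos by auto
  obtain x y where xy: "0 < x" "0 < y" "u x y \<le> 0" "\<bar>e x y\<bar> \<le> E" "x0 + y0 + real n * (m / 2) \<le> x + y"
    using chain by blast
  have s: "R \<le> x + y" "E / \<rho> \<le> x + y" "0 < x + y" using xy n xy0 by linarith+
  have "x / (x + y) - t0 = e x y / (x + y)" using s by (simp add: e_def field_simps)
  then have "\<bar>x / (x + y) - t0\<bar> = \<bar>e x y\<bar> / (x + y)" using s by simp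
  also have "\<dots> \<le> E / (x + y)" using xy s by (intro divide_right_mono) auto
  also have "\<dots> \<le> \<rho>" using s \<rho> by (simp add: field_simps)
  finally show False using pos[OF xy(1,2) s(1)] xy(3) by auto
qed

end

section \<open>Wasserstein distance and monotone families\<close>

lemma prob_on_real_distribution: "prob_on a b M \<Longrightarrow> real_distribution M"
  by (simp add: prob_on_def real_distribution_def real_distribution_axioms_def)

text \<open>Shows that the infimum in \<open>wasserstein1\<close> ranges over a nonempty set, so
  that it is approached by actual couplings.\<close>

lemma coupling_pair_measure:
  assumes M: "real_distribution M" and N: "real_distribution N"
  shows "coupling M N (M \<Otimes>\<^sub>M N)"
proof -
  interpret M: real_distribution M by fact
  interpret N: real_distribution N by fact
  interpret pair_prob_space M N ..
  have sets: "sets (M \<Otimes>\<^sub>M N) = sets (borel \<Otimes>\<^sub>M borel)"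
    by (intro sets_pair_measure_cong) auto
  have "distr (M \<Otimes>\<^sub>M N) borel fst = distr (M \<Otimes>\<^sub>M N) M fst"
    by (intro distr_cong) auto
  moreover have "distr (M \<Otimes>\<^sub>M N) borel snd = N"
  proof (rule measure_eqI)
    fix A assume A: "A \<in> sets (distr (M \<Otimes>\<^sub>M N) borel snd)"
    then have "emeasure (distr (M \<Otimes>\<^sub>M N) borel snd) A = emeasure (M \<Otimes>\<^sub>M N) (UNIV \<times> A)"
      by (subst emeasure_distr) (auto simp: space_pair_measure intro!: arg_cong2[where f = emeasure])
    also have "\<dots> = emeasure N A"
      using A M.emeasure_space_1 by (subst N.emeasure_pair_measure_Times) auto
    finally show "emeasure (distr (M \<Otimes>\<^sub>M N) borel snd) A = emeasure N A" .
  qed auto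
  ultimately show ?thesis
    unfolding coupling_def using sets N.distr_pair_fst[of M] prob_space_axioms by auto
qed

text \<open>If \<open>f\<close> lies in the interval and \<open>g\<close> outside the enlarged one,
  they differ by at least \<open>e\<close>; Markov's inequality bounds the probability of
  this.\<close>

lemma measure_distr_interval_le:
  assumes "prob_space \<pi>" and f: "f \<in> borel_measurable \<pi>" and g: "g \<in> borel_measurable \<pi>"
    and int: "integrable \<pi> (\<lambda>p. \<bar>f p - g p\<bar>)" and e: "0 < e"
  shows "measure (distr \<pi> borel f) {a..b}
    \<le> measure (distr \<pi> borel g) {a - e..b + e} + (\<integral>p. \<bar>f p - g p\<bar> \<partial>\<pi>) / (e :: real)"
proof -
  interpret prob_space \<pi> by fact
  note [measurable] = f g
  have "measure (distr \<pi> borel f) {a..b} = prob (f -` {a..b} \<inter> space \<pi>)"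
    by (rule measure_distr) auto
  also have "\<dots> \<le> prob ((g -` {a - e..b + e} \<inter> space \<pi>) \<union> {p \<in> space \<pi>. e \<le> \<bar>f p - g p\<bar>})"
    by (intro finite_measure_mono) auto
  also have "\<dots> \<le> prob (g -` {a - e..b + e} \<inter> space \<pi>) + prob {p \<in> space \<pi>. e \<le> \<bar>f p - g p\<bar>}"
    by (intro measure_subadditive) auto
  also have "prob (g -` {a - e..b + e} \<inter> space \<pi>) = measure (distr \<pi> borel g) {a - e..b + e}"
    by (rule measure_distr[symmetric]) auto
  also have "prob {p \<in> space \<pi>. e \<le> \<bar>f p - g p\<bar>} \<le> (\<integral>p. \<bar>f p - g p\<bar> \<partial>\<pi>) / e"
    using e int by (intro integral_Markov_inequality_measure[where A = "space \<pi>"]) auto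
  finally show ?thesis by simp
qed

text \<open>A single coupling of cost below \<open>e * d\<close> yields both inequalities, so
  symmetry of the distance does not enter.\<close>

lemma wasserstein_interval_le:
  assumes M: "prob_on 0 1 M" and N: "prob_on 0 1 N" and W: "wasserstein1 M N < e * d" and e: "0 < e"
  shows "measure M {a..b} \<le> measure N {a - e..b + e} + d"
    and "measure N {a..b} \<le> measure M {a - e..b + e} + d"
proof -
  have "coupling M N (M \<Otimes>\<^sub>M N)"
    using M N by (intro coupling_pair_measure prob_on_real_distribution)
  then obtain \<pi> where \<pi>: "coupling M N \<pi>" and lt: "(\<integral>p. \<bar>fst p - snd p\<bar> \<partial>\<pi>) < e * d"
    using cInf_lessD[OF _ W[unfolded wasserstein1_def]] by blast
  interpret prob_space \<pi> using \<pi> by (simp add: coupling_def)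
  have sets: "sets \<pi> = sets (borel \<Otimes>\<^sub>M borel)" using \<pi> by (simp add: coupling_def)
  have fst: "fst \<in> borel_measurable \<pi>" and snd: "snd \<in> borel_measurable \<pi>"
    using measurable_cong_sets[OF sets refl] by auto
  note [measurable] = fst snd
  have M_eq: "distr \<pi> borel fst = M" and N_eq: "distr \<pi> borel snd = N"
    using \<pi> by (auto simp: coupling_def)
  \<comment> \<open>Both marginals live on [0, 1], so the cost is bounded by 1 and its integral is a
    genuine one.\<close>
  have "AE p in \<pi>. fst p \<in> {0..1}"
    using M prob_space.AE_prob_1[of M "{0..1}"] unfolding prob_on_def M_eq[symmetric]
    by (intro AE_distrD[OF fst]) blast
  moreover have "AE p in \<pi>. snd p \<in> {0..1}"
    using N prob_space.AE_prob_1[of N "{0..1}"] unfolding prob_on_def N_eq[symmetric]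
    by (intro AE_distrD[OF snd]) blast
  ultimately have int: "integrable \<pi> (\<lambda>p. \<bar>fst p - snd p\<bar>)"
    by (intro integrable_const_bound[where B = 1]) auto
  have le: "(\<integral>p. \<bar>fst p - snd p\<bar> \<partial>\<pi>) / e \<le> d"
    using lt e by (simp add: field_simps)
  show "measure M {a..b} \<le> measure N {a - e..b + e} + d"
    using measure_distr_interval_le[OF prob_space_axioms fst snd int e, of a b] le
    unfolding M_eq N_eq by simp
  show "measure N {a..b} \<le> measure M {a - e..b + e} + d"
    using measure_distr_interval_le[OF prob_space_axioms snd fst _ e, of a b] int le
    unfolding M_eq N_eq by (simp add: abs_minus_commute)
qed

lemma interval_enlarge:
  assumes "real_distribution M" and "measure M {a..b} < c"
  shows "\<exists>e>0. measure M {a - e..b + e} < c"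
proof -
  interpret real_distribution M by fact
  have "(\<lambda>n. measure M {a - 1 / real (Suc n)..b + 1 / real (Suc n)})
      \<longlonglongrightarrow> measure M (\<Inter>n. {a - 1 / real (Suc n)..b + 1 / real (Suc n)})"
  proof (rule finite_Lim_measure_decseq)
    have "1 / real (Suc n) \<le> 1 / real (Suc m)" if "m \<le> n" for m n
      using that by (intro divide_left_mono) auto
    then show "decseq (\<lambda>n. {a - 1 / real (Suc n)..b + 1 / real (Suc n)})"
      by (fastforce simp: decseq_def)
  qed auto
  also have "(\<Inter>n. {a - 1 / real (Suc n)..b + 1 / real (Suc n)}) = {a..b}"
  proof (intro equalityI subsetI)
    fix x assume x: "x \<in> (\<Inter>n. {a - 1 / real (Suc n)..b + 1 / real (Suc n)})"
    have lim: "(\<lambda>n. 1 / real (Suc n)) \<longlonglongrightarrow> 0"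
      by (rule LIMSEQ_Suc[OF lim_1_over_n])
    have "(\<lambda>n. a - 1 / real (Suc n)) \<longlonglongrightarrow> a - 0" "(\<lambda>n. b + 1 / real (Suc n)) \<longlonglongrightarrow> b + 0"
      by (intro tendsto_intros lim)+
    then have "a - 0 \<le> x" "x \<le> b + 0"
      using x by (auto intro: LIMSEQ_le_const LIMSEQ_le_const2)
    then show "x \<in> {a..b}" by simp
  next
    fix x assume x: "x \<in> {a..b}"
    have "0 \<le> 1 / real (Suc n)" for n by simp
    then have "a - 1 / real (Suc n) \<le> x" "x \<le> b + 1 / real (Suc n)" for n
      using x by (smt (verit) atLeastAtMost_iff)+
    then show "x \<in> (\<Inter>n. {a - 1 / real (Suc n)..b + 1 / real (Suc n)})"
      by (intro INT_I) (simp del: of_nat_Suc)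
  qed
  finally have "eventually (\<lambda>n. measure M {a - 1 / real (Suc n)..b + 1 / real (Suc n)} < c) sequentially"
    using assms(2) by (rule order_tendstoD)
  then obtain n where "measure M {a - 1 / real (Suc n)..b + 1 / real (Suc n)} < c"
    by (auto simp: eventually_sequentially)
  then show ?thesis by (intro exI[of _ "1 / real (Suc n)"]) auto
qed

text \<open>The mass of a closed interval is only upper semicontinuous, since nearby measures may
  place it just outside. This still yields measurability in the step size.\<close>

lemma W_continuous_on_interval_usc:
  assumes f: "W_continuous_on A f" and prob: "\<And>p. p \<in> A \<Longrightarrow> prob_on 0 1 (f p)"
    and p: "p \<in> A" and less: "measure (f p) {a..b} < c"
  shows "\<exists>d>0. \<forall>q\<in>A. dist q p < d \<longrightarrow> measure (f q) {a..b} < c"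
proof -
  obtain c' where c': "measure (f p) {a..b} < c'" "c' < c" using dense[OF less] by blast
  obtain e where e: "0 < e" "measure (f p) {a - e..b + e} < c'"
    using interval_enlarge[OF prob_on_real_distribution[OF prob[OF p]] c'(1)] by blast
  have "0 < e * (c - c')" using e c' by simp
  then obtain d where d: "0 < d" "\<And>q. q \<in> A \<Longrightarrow> dist q p < d \<Longrightarrow> wasserstein1 (f q) (f p) < e * (c - c')"
    using f p unfolding W_continuous_on_def by blast
  have "measure (f q) {a..b} < c" if "q \<in> A" "dist q p < d" for q
    using wasserstein_interval_le(1)[OF prob[OF that(1)] prob[OF p] d(2)[OF that] e(1), of a b] e(2)
    by simp
  with d(1) show ?thesis by blast
qed

lemma borel_measurable_usc:
  fixes h :: "real \<Rightarrow> real"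
  assumes "\<And>k c. k \<in> S \<Longrightarrow> h k < c \<Longrightarrow> \<exists>d>0. \<forall>k'\<in>S. dist k' k < d \<longrightarrow> h k' < c"
  shows "h \<in> borel_measurable (restrict_space borel S)"
  unfolding borel_measurable_iff_less
proof
  fix c
  have "openin (top_of_set S) {k \<in> S. h k < c}"
    unfolding openin_euclidean_subtopology_iff using assms by fastforce
  then obtain T where T: "open T" "{k \<in> S. h k < c} = S \<inter> T" by (auto simp: openin_open)
  then show "{w \<in> space (restrict_space borel S). h w < c} \<in> sets (restrict_space borel S)"
    by (auto simp: sets_restrict_space space_restrict_space)
qed

text \<open>Monotone functions have countably many discontinuities, so the uncountable set
  \<open>T\<close> contains a common continuity point of \<open>f\<close> and \<open>g\<close>, and
  the gap persists around it.\<close>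

lemma antimono_gap_interval:
  fixes f g :: "real \<Rightarrow> real"
  assumes f: "\<And>s t. 0 < s \<Longrightarrow> s \<le> t \<Longrightarrow> t < 1 \<Longrightarrow> f t \<le> f s"
    and g: "\<And>s t. 0 < s \<Longrightarrow> s \<le> t \<Longrightarrow> t < 1 \<Longrightarrow> g t \<le> g s"
    and T: "uncountable T" "T \<subseteq> {0<..<1}" "\<And>t. t \<in> T \<Longrightarrow> g t < f t"
  shows "\<exists>t0 \<rho> \<kappa>. 0 < \<rho> \<and> 0 < \<kappa> \<and> 0 < t0 - \<rho> \<and> t0 + \<rho> < 1 \<and> (\<forall>t. \<bar>t - t0\<bar> \<le> \<rho> \<longrightarrow> \<kappa> \<le> f t - g t)"
proof -
  define D where "D h = {a \<in> {0<..<1}. \<not> isCont (\<lambda>t. - h t) a}" for h :: "real \<Rightarrow> real"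
  have "countable (D f)" "countable (D g)"
    unfolding D_def by (intro mono_on_ctble_discont_open mono_onI; use f g in force)+
  then have "uncountable (T - (D f \<union> D g))"
    by (intro uncountable_minus_countable T(1)) simp
  then have "T - (D f \<union> D g) \<noteq> {}"
    by (metis countable_empty)
  then obtain t0 where "t0 \<in> T" "t0 \<notin> D f" "t0 \<notin> D g" by auto
  then have t0: "t0 \<in> T" "isCont (\<lambda>t. - f t) t0" "isCont (\<lambda>t. - g t) t0"
    using T(2) by (auto simp: D_def)
  define \<kappa> where "\<kappa> = (f t0 - g t0) / 2"
  have \<kappa>: "0 < \<kappa>" "\<kappa> < f t0 - g t0" using T(3)[OF t0(1)] by (auto simp: \<kappa>_def)
  have "isCont (\<lambda>t. f t - g t) t0"
    using continuous_diff[OF t0(3,2)] by simp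
  then have "eventually (\<lambda>t. \<kappa> < f t - g t) (at t0)"
    using \<kappa>(2) unfolding isCont_def by (rule order_tendstoD)
  then obtain d where d: "0 < d" "\<And>t. t \<noteq> t0 \<Longrightarrow> dist t t0 < d \<Longrightarrow> \<kappa> < f t - g t"
    by (auto simp: eventually_at)
  have t01: "0 < t0" "t0 < 1" using t0 T(2) by auto
  define \<rho> where "\<rho> = min (d / 2) (min (t0 / 2) ((1 - t0) / 2))"
  have "\<kappa> \<le> f t - g t" if "\<bar>t - t0\<bar> \<le> \<rho>" for t
    using d(2)[of t] \<kappa> that d(1) by (cases "t = t0") (auto simp: \<rho>_def dist_real_def)
  moreover have "0 < \<rho>" "0 < t0 - \<rho>" "t0 + \<rho> < 1"
    using d(1) t01 by (auto simp: \<rho>_def min_def field_simps)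
  ultimately show ?thesis using \<kappa> by blast
qed

section \<open>Atoms of a stochastically monotone family\<close>

locale monotone_family =
  fixes \<phi> :: "real \<Rightarrow> real measure"
  assumes prob: "\<And>t. 0 \<le> t \<Longrightarrow> t \<le> 1 \<Longrightarrow> prob_on 0 1 (\<phi> t)"
    and mono: "\<And>s t. 0 \<le> s \<Longrightarrow> s \<le> t \<Longrightarrow> t \<le> 1 \<Longrightarrow> st_le (\<phi> s) (\<phi> t)"
begin

lemma real_dist: "0 \<le> t \<Longrightarrow> t \<le> 1 \<Longrightarrow> real_distribution (\<phi> t)"
  using prob prob_on_real_distribution by blast

lemma atMost_antimono:
  "0 \<le> s \<Longrightarrow> s \<le> t \<Longrightarrow> t \<le> 1 \<Longrightarrow> measure (\<phi> t) {..z} \<le> measure (\<phi> s) {..z}"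
  using mono unfolding st_le_def by blast

text \<open>The masses of open half-lines are left limits of the distribution functions, so the
  order passes to them.\<close>

lemma lessThan_antimono:
  assumes "0 \<le> s" "s \<le> t" "t \<le> 1"
  shows "measure (\<phi> t) {..<z} \<le> measure (\<phi> s) {..<z}"
proof -
  interpret s: real_distribution "\<phi> s" using assms by (intro real_dist) auto
  interpret t: real_distribution "\<phi> t" using assms by (intro real_dist) auto
  show ?thesis
    using atMost_antimono[OF assms]
    by (intro tendsto_le[OF _ s.cdf_at_left t.cdf_at_left]) (auto simp: cdf_def intro!: always_eventually)
qed

lemma singleton_eq:
  assumes "0 \<le> t" "t \<le> 1"
  shows "measure (\<phi> t) {z} = measure (\<phi> t) {..z} - measure (\<phi> t) {..<z}"
proof -
  interpret real_distribution "\<phi> t" using assms by (rule real_dist)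
  have "{..z} - {..<z} = {z}" by auto
  moreover have "prob ({..z} - {..<z}) = prob {..z} - prob {..<z}"
    by (rule finite_measure_Diff) auto
  ultimately show ?thesis by simp
qed

text \<open>The atom at \<open>z\<close> is the gap between two antitone functions of
  \<open>t\<close>, so \<open>antimono_gap_interval\<close> applies.\<close>

lemma mass_interval:
  assumes T: "uncountable {t \<in> {c<..<d}. measure (\<phi> t) {z} \<noteq> 0}" and cd: "0 \<le> c" "d \<le> 1"
  shows "\<exists>t0 \<rho> \<kappa>. 0 < \<rho> \<and> 0 < \<kappa> \<and> 0 < t0 - \<rho> \<and> t0 + \<rho> < 1 \<and>
    (\<forall>t. \<bar>t - t0\<bar> \<le> \<rho> \<longrightarrow> \<kappa> \<le> measure (\<phi> t) {z})"
proof -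
  have "\<exists>t0 \<rho> \<kappa>. 0 < \<rho> \<and> 0 < \<kappa> \<and> 0 < t0 - \<rho> \<and> t0 + \<rho> < 1 \<and>
    (\<forall>t. \<bar>t - t0\<bar> \<le> \<rho> \<longrightarrow> \<kappa> \<le> measure (\<phi> t) {..z} - measure (\<phi> t) {..<z})"
  proof (rule antimono_gap_interval[OF _ _ T])
    fix t assume t: "t \<in> {t \<in> {c<..<d}. measure (\<phi> t) {z} \<noteq> 0}"
    then have "0 \<le> t" "t \<le> 1" "0 < measure (\<phi> t) {z}"
      using cd by (auto simp: zero_less_measure_iff)
    then show "measure (\<phi> t) {..<z} < measure (\<phi> t) {..z}" by (simp add: singleton_eq)
  qed (use cd in \<open>auto intro: atMost_antimono lessThan_antimono\<close>)
  then obtain t0 \<rho> \<kappa> where *: "0 < \<rho>" "0 < \<kappa>" "0 < t0 - \<rho>" "t0 + \<rho> < 1"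
    "\<And>t. \<bar>t - t0\<bar> \<le> \<rho> \<Longrightarrow> \<kappa> \<le> measure (\<phi> t) {..z} - measure (\<phi> t) {..<z}" by blast
  have "\<kappa> \<le> measure (\<phi> t) {z}" if "\<bar>t - t0\<bar> \<le> \<rho>" for t
  proof -
    have "0 \<le> t" "t \<le> 1" using that *(3,4) by auto
    then show ?thesis using *(5)[OF that] by (simp add: singleton_eq)
  qed
  with * show ?thesis by blast
qed

lemma Phi_nonzero_uncountable:
  assumes "Phi \<phi> {z} \<noteq> 0"
  shows "uncountable {t \<in> {0<..<1}. measure (\<phi> t) {z} \<noteq> 0}"
proof
  assume "countable {t \<in> {0<..<1}. measure (\<phi> t) {z} \<noteq> 0}"
  then have "countable ({0, 1} \<union> {t \<in> {0<..<1}. measure (\<phi> t) {z} \<noteq> 0})" by simp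
  then have "{0, 1} \<union> {t \<in> {0<..<1}. measure (\<phi> t) {z} \<noteq> 0} \<in> null_sets lborel"
    by (rule countable_imp_null_set_lborel)
  then have "AE t in lborel. indicator {0..1} t *\<^sub>R measure (\<phi> t) {z} = 0"
    by (rule AE_I') (auto simp: indicator_def less_le)
  then have "Phi \<phi> {z} = 0"
    unfolding Phi_def set_lebesgue_integral_def by (rule integral_eq_zero_AE)
  with assms show False by contradiction
qed

text \<open>Atoms at \<open>z\<close> throughout an interval would be bounded below by some \<kappa>
  on an interval of length \<open>2 * \<rho>\<close>, which would give \<Phi> an atom of mass at
  least \<open>2 * \<rho> * \<kappa>\<close>.\<close>

lemma Phi_zero_dense:
  assumes Phi: "Phi \<phi> {z} = 0" and cd: "0 \<le> c" "c < d" "d \<le> 1"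
  shows "\<exists>t. c < t \<and> t < d \<and> measure (\<phi> t) {z} = 0"
proof (rule ccontr)
  assume "\<not> ?thesis"
  then have "{t \<in> {c<..<d}. measure (\<phi> t) {z} \<noteq> 0} = {c<..<d}" by auto
  then have "uncountable {t \<in> {c<..<d}. measure (\<phi> t) {z} \<noteq> 0}"
    using cd uncountable_open_interval[of c d] by simp
  from mass_interval[OF this cd(1,3)] obtain t0 \<rho> \<kappa> where *: "0 < \<rho>" "0 < \<kappa>" "0 < t0 - \<rho>" "t0 + \<rho> < 1"
    "\<And>t. \<bar>t - t0\<bar> \<le> \<rho> \<Longrightarrow> \<kappa> \<le> measure (\<phi> t) {z}" by blast
  \<comment> \<open>A non-integrable function would have integral 0 by convention, so integrability
    has to be shown; measurability comes from monotonicity.\<close>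
  have "(\<lambda>t. - measure (\<phi> t) {..z}) \<in> borel_measurable (restrict_space borel {0..1})"
    "(\<lambda>t. - measure (\<phi> t) {..<z}) \<in> borel_measurable (restrict_space borel {0..1})"
    by (intro borel_measurable_mono_on_fnc mono_onI;
        use atMost_antimono lessThan_antimono in force)+
  then have "(\<lambda>t. (- measure (\<phi> t) {..<z}) - (- measure (\<phi> t) {..z})) \<in> borel_measurable (restrict_space borel {0..1})"
    by (rule borel_measurable_diff[rotated])
  then have "(\<lambda>t. measure (\<phi> t) {z}) \<in> borel_measurable (restrict_space borel {0..1})"
    by (rule measurable_cong[THEN iffD1, rotated]) (auto simp: space_restrict_space singleton_eq)
  then have meas: "(\<lambda>t. indicator {0..1} t *\<^sub>R measure (\<phi> t) {z}) \<in> borel_measurable lborel"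
    by (subst (asm) borel_measurable_restrict_space_iff) (auto simp: mult.commute)
  have int: "integrable lborel (\<lambda>t. indicator {0..1} t *\<^sub>R measure (\<phi> t) {z})"
  proof (rule Bochner_Integration.integrable_bound[OF _ meas])
    show "integrable lborel (indicator {0..1} :: real \<Rightarrow> real)" by simp
    show "AE t in lborel. norm (indicator {0..1} t *\<^sub>R measure (\<phi> t) {z}) \<le> norm (indicator {0..1} t :: real)"
      using real_dist by (intro AE_I2)
        (auto simp: indicator_def real_distribution_def intro: prob_space.prob_le_1)
  qed
  have int': "integrable lborel (\<lambda>t. \<kappa> * indicator {t0 - \<rho>..t0 + \<rho>} t)"
    using *(1) by (intro integrable_mult_right integrable_real_indicator) auto
  have "(\<integral>t. \<kappa> * indicator {t0 - \<rho>..t0 + \<rho>} t \<partial>lborel) \<le> Phi \<phi> {z}"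
    unfolding Phi_def set_lebesgue_integral_def
    using * by (intro integral_mono[OF int' int]) (auto simp: indicator_def)
  moreover have "(\<integral>t. \<kappa> * indicator {t0 - \<rho>..t0 + \<rho>} t \<partial>lborel) = \<kappa> * (2 * \<rho>)"
    using *(1) by simp
  ultimately show False using Phi *(1,2) by (simp add: mult_le_0_iff)
qed

text \<open>By the stochastic order, the distribution functions at \<open>a\<close> and
  \<open>b\<close> control all those between. Right continuity at \<open>a\<close> and the left
  limit at \<open>b\<close> then give one \<open>e\<close> for all \<open>t\<close>.\<close>

lemma interval_mass_bound:
  assumes ab: "0 \<le> a" "a \<le> b" "b \<le> 1" and \<delta>: "0 < \<delta>"
  shows "\<exists>e>0. \<forall>t. a \<le> t \<longrightarrow> t \<le> b \<longrightarrow>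
    measure (\<phi> t) {z - e..z + e} \<le> measure (\<phi> a) {..z} - measure (\<phi> b) {..<z} + \<delta>"
proof -
  interpret a: real_distribution "\<phi> a" using ab by (intro real_dist) auto
  interpret b: real_distribution "\<phi> b" using ab by (intro real_dist) auto
  have "(cdf (\<phi> a) \<longlongrightarrow> cdf (\<phi> a) z) (at_right z)"
    using a.cdf_is_right_cont by (simp add: continuous_within)
  then have "eventually (\<lambda>w. cdf (\<phi> a) w < measure (\<phi> a) {..z} + \<delta> / 2) (at_right z)"
    using \<delta> by (intro order_tendstoD) (auto simp: cdf_def)
  then obtain w where w: "z < w" "\<And>y. z < y \<Longrightarrow> y < w \<Longrightarrow> measure (\<phi> a) {..y} < measure (\<phi> a) {..z} + \<delta> / 2"
    by (auto simp: eventually_at_right[of z "z + 1"] cdf_def)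
  have "eventually (\<lambda>w. measure (\<phi> b) {..<z} - \<delta> / 2 < cdf (\<phi> b) w) (at_left z)"
    using \<delta> by (intro order_tendstoD[OF b.cdf_at_left]) auto
  then obtain v where v: "v < z" "\<And>y. v < y \<Longrightarrow> y < z \<Longrightarrow> measure (\<phi> b) {..<z} - \<delta> / 2 < measure (\<phi> b) {..y}"
    by (auto simp: eventually_at_left[of "z - 1" z] cdf_def)
  define e where "e = min ((w - z) / 2) ((z - v) / 3)"
  have e: "0 < e" "z + e < w" "v < z - 2 * e" using w(1) v(1) by (auto simp: e_def min_def field_simps)
  have "measure (\<phi> t) {z - e..z + e} \<le> measure (\<phi> a) {..z} - measure (\<phi> b) {..<z} + \<delta>"
    if t: "a \<le> t" "t \<le> b" for t
  proof -
    interpret t: real_distribution "\<phi> t" using ab t by (intro real_dist) auto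
    \<comment> \<open>The factor 2 keeps the endpoint \<open>z - e\<close> out of the half-line that
      is removed.\<close>
    have "measure (\<phi> t) {z - e..z + e} \<le> measure (\<phi> t) ({..z + e} - {..z - 2 * e})"
      using e by (intro t.finite_measure_mono) auto
    also have "\<dots> = measure (\<phi> t) {..z + e} - measure (\<phi> t) {..z - 2 * e}"
      using e by (intro t.finite_measure_Diff) auto
    also have "\<dots> \<le> measure (\<phi> a) {..z + e} - measure (\<phi> b) {..z - 2 * e}"
      using ab t by (intro diff_mono atMost_antimono) auto
    also have "\<dots> \<le> measure (\<phi> a) {..z} - measure (\<phi> b) {..<z} + \<delta>"
      using w(2)[of "z + e"] v(2)[of "z - 2 * e"] e by simp
    finally show ?thesis .
  qed
  with e show ?thesis by blast
qed

text \<open>Arbitrarily close to \<open>t0\<close>, on either side, there is a parameter without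
  atom at \<open>z\<close>, where both half-line masses agree. Hence both have the same one-sided
  limits at \<open>t0\<close>, and the gap over a short interval on one side of \<open>t0\<close> is
  small, uniformly in \<eta>.\<close>

lemma one_sided_gaps:
  assumes Phi: "Phi \<phi> {z} = 0" and t0: "0 < t0" "t0 < 1" and \<epsilon>: "0 < \<epsilon>"
  shows "\<exists>\<rho>>0. 0 \<le> t0 - \<rho> \<and> t0 + \<rho> \<le> 1 \<and> (\<forall>\<eta>. 0 < \<eta> \<longrightarrow> \<eta> \<le> \<rho> \<longrightarrow>
    measure (\<phi> (t0 + \<eta>)) {..z} - measure (\<phi> (t0 + \<rho>)) {..<z} \<le> \<epsilon> \<and>
    measure (\<phi> (t0 - \<rho>)) {..z} - measure (\<phi> (t0 - \<eta>)) {..<z} \<le> \<epsilon>)"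
proof -
  define f g where "f t = measure (\<phi> t) {..z}" and "g t = measure (\<phi> t) {..<z}" for t
  have f: "f t \<le> f s" and g: "g t \<le> g s" if "0 \<le> s" "s \<le> t" "t \<le> 1" for s t
    using that by (auto simp: f_def g_def intro: atMost_antimono lessThan_antimono)
  have eq: "\<exists>t. c < t \<and> t < d \<and> f t = g t" if "0 \<le> c" "c < d" "d \<le> 1" for c d
    using Phi_zero_dense[OF Phi that] singleton_eq[of _ z] that by (force simp: f_def g_def)
  have bnd: "0 \<le> g t" "g t \<le> 1" "0 \<le> f t" if "0 \<le> t" "t \<le> 1" for t
    using real_dist[OF that] by (auto simp: f_def g_def real_distribution_def intro: prob_space.prob_le_1)
  \<comment> \<open>As \<open>g\<close> is antitone, \<open>L\<close> is its right limit at
    \<open>t0\<close>; likewise \<open>L'\<close> below is the left limit of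
    \<open>f\<close>.\<close>
  define L where "L = Sup (g ` {t0<..1})"
  have L: "g t \<le> L" if "t0 < t" "t \<le> 1" for t
    unfolding L_def using that t0 bnd by (intro cSup_upper) (auto intro!: bdd_aboveI[of _ 1])
  have "\<exists>y \<in> g ` {t0<..1}. L - \<epsilon> < y"
    using t0 \<epsilon> unfolding L_def by (intro less_cSupD) auto
  then obtain b where b: "t0 < b" "b \<le> 1" "L - \<epsilon> < g b" by auto
  define L' where "L' = Inf (f ` {0..<t0})"
  have L': "L' \<le> f t" if "0 \<le> t" "t < t0" for t
    unfolding L'_def using that t0 bnd by (intro cInf_lower) (auto intro!: bdd_belowI[of _ 0])
  have "\<exists>y \<in> f ` {0..<t0}. y < L' + \<epsilon>"
    using t0 \<epsilon> unfolding L'_def by (intro cInf_lessD) auto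
  then obtain a where a: "0 \<le> a" "a < t0" "f a < L' + \<epsilon>" by auto
  define \<rho> where "\<rho> = min (b - t0) (t0 - a)"
  have \<rho>: "0 < \<rho>" "a \<le> t0 - \<rho>" "t0 + \<rho> \<le> b" using a b by (auto simp: \<rho>_def)
  have "f (t0 + \<eta>) - g (t0 + \<rho>) \<le> \<epsilon> \<and> f (t0 - \<rho>) - g (t0 - \<eta>) \<le> \<epsilon>"
    if \<eta>: "0 < \<eta>" "\<eta> \<le> \<rho>" for \<eta>
  proof
    obtain s where s: "t0 < s" "s < t0 + \<eta>" "f s = g s"
      using eq[of t0 "t0 + \<eta>"] t0 \<eta> \<rho> b by auto
    have "f (t0 + \<eta>) \<le> f s" using s(1,2) t0 \<eta> \<rho> b by (intro f) auto
    moreover have "g s \<le> L" using s(1,2) t0 \<eta> \<rho> b by (intro L) auto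
    moreover have "g b \<le> g (t0 + \<rho>)" using t0 \<rho> b by (intro g) auto
    ultimately show "f (t0 + \<eta>) - g (t0 + \<rho>) \<le> \<epsilon>" using s(3) b by linarith
    obtain r where r: "t0 - \<eta> < r" "r < t0" "f r = g r"
      using eq[of "t0 - \<eta>" t0] t0 \<eta> \<rho> a by auto
    have "g r \<le> g (t0 - \<eta>)" using r(1,2) t0 \<eta> \<rho> a by (intro g) auto
    moreover have "L' \<le> f r" using r(1,2) t0 \<eta> \<rho> a by (intro L') auto
    moreover have "f (t0 - \<rho>) \<le> f a" using t0 \<rho> a by (intro f) auto
    ultimately show "f (t0 - \<rho>) - g (t0 - \<eta>) \<le> \<epsilon>" using r(3) a by linarith
  qed
  then show ?thesis using \<rho> a b unfolding f_def g_def by (intro exI[of _ \<rho>]) auto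
qed

end

section \<open>Point masses\<close>

lemma urn_restrict_space:
  assumes \<mu>: "prob_on 0 \<beta> \<mu>" and \<nu>: "prob_on 0 \<beta> \<nu>"
    and mean: "(\<integral>k. k \<partial>\<mu>) = m" "(\<integral>k. k \<partial>\<nu>) = m" and m: "0 < m"
  shows "urn \<beta> m (restrict_space \<mu> {0..\<beta>}) (restrict_space \<nu> {0..\<beta>})"
proof -
  have *: "prob_space (restrict_space M {0..\<beta>}) \<and>
      sets (restrict_space M {0..\<beta>}) = sets (restrict_space borel {0..\<beta>}) \<and>
      (\<integral>k. k \<partial>restrict_space M {0..\<beta>}) = (\<integral>k. k \<partial>M)" if M: "prob_on 0 \<beta> M" for M
  proof (intro conjI)
    interpret real_distribution M using M by (rule prob_on_real_distribution)
    have one: "prob {0..\<beta>} = 1" using M by (simp add: prob_on_def)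
    then show "prob_space (restrict_space M {0..\<beta>})"
      by (intro prob_space_restrict_space) (auto simp: emeasure_eq_measure)
    show "sets (restrict_space M {0..\<beta>}) = sets (restrict_space borel {0..\<beta>})"
      by (intro sets_restrict_space_cong) simp
    have "(\<integral>k. k \<partial>restrict_space M {0..\<beta>}) = (\<integral>k. indicator {0..\<beta>} k *\<^sub>R k \<partial>M)"
      by (intro integral_restrict_space) auto
    also have "\<dots> = (\<integral>k. k \<partial>M)"
      using AE_prob_1[OF one] by (intro integral_cong_AE) auto
    finally show "(\<integral>k. k \<partial>restrict_space M {0..\<beta>}) = (\<integral>k. k \<partial>M)" .
  qed
  show ?thesis
    using *[OF \<mu>] *[OF \<nu>] mean m by (intro urn.intro) auto
qed

text \<open>The functional equation at the set \<open>{a..b}\<close> is an equality, which makes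
  both signs superharmonic. Closed intervals suffice: they include the points, and semicontinuity
  makes their masses integrable.\<close>

lemma is_G_harmonic:
  assumes \<mu>: "prob_on 0 \<beta> \<mu>" and \<nu>: "prob_on 0 \<beta> \<nu>" and G: "is_G \<beta> \<mu> \<nu> \<phi> G"
    and urn: "urn \<beta> m (restrict_space \<mu> {0..\<beta>}) (restrict_space \<nu> {0..\<beta>})"
  defines "P \<equiv> restrict_space \<mu> {0..\<beta>}" and "Q \<equiv> restrict_space \<nu> {0..\<beta>}"
  shows "urn.superharmonic P Q 0 (\<lambda>x y. measure (G (x, y)) {a..b})"
    and "urn.superharmonic P Q 0 (\<lambda>x y. - measure (G (x, y)) {a..b})"
proof -
  interpret urn \<beta> m P Q using urn by (simp add: P_def Q_def)
  define u where "u x y = measure (G (x, y)) {a..b}" for x y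
  have prob_G: "prob_on 0 1 (G p)" if "p \<in> SS" for p using G that by (auto simp: is_G_def)
  have cont: "W_continuous_on SS G" using G by (simp add: is_G_def)
  have bnd: "\<bar>u x y\<bar> \<le> 1" if "0 < x" "0 < y" for x y
    using prob_G[of "(x, y)"] that
    by (auto simp: u_def SS_def prob_on_def intro: prob_space.prob_le_1)
  have i1: "integrable P (\<lambda>k. u (x + k) y)" if xy: "0 < x" "0 < y" for x y
  proof (rule integrable_bounded[where C = 1, OF disjI1[OF refl] borel_measurable_usc])
    fix k c :: real assume k: "k \<in> {0..\<beta>}" and less: "u (x + k) y < c"
    have "(x + k, y) \<in> SS" using k xy by (simp add: SS_def)
    from W_continuous_on_interval_usc[OF cont prob_G this less[unfolded u_def]]
    obtain d where d: "0 < d" "\<And>q. q \<in> SS \<Longrightarrow> dist q (x + k, y) < d \<Longrightarrow> measure (G q) {a..b} < c"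
      by blast
    show "\<exists>d>0. \<forall>k'\<in>{0..\<beta>}. dist k' k < d \<longrightarrow> u (x + k') y < c"
      using d xy unfolding u_def
      by (intro exI[of _ d]) (auto simp: SS_def dist_Pair_Pair dist_real_def)
  qed (use bnd xy in auto)
  have i2: "integrable Q (\<lambda>k. u x (y + k))" if xy: "0 < x" "0 < y" for x y
  proof (rule integrable_bounded[where C = 1, OF disjI2[OF refl] borel_measurable_usc])
    fix k c :: real assume k: "k \<in> {0..\<beta>}" and less: "u x (y + k) < c"
    have "(x, y + k) \<in> SS" using k xy by (simp add: SS_def)
    from W_continuous_on_interval_usc[OF cont prob_G this less[unfolded u_def]]
    obtain d where d: "0 < d" "\<And>q. q \<in> SS \<Longrightarrow> dist q (x, y + k) < d \<Longrightarrow> measure (G q) {a..b} < c"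
      by blast
    show "\<exists>d>0. \<forall>k'\<in>{0..\<beta>}. dist k' k < d \<longrightarrow> u x (y + k') < c"
      using d xy unfolding u_def
      by (intro exI[of _ d]) (auto simp: SS_def dist_Pair_Pair dist_real_def)
  qed (use bnd xy in auto)
  interpret P: prob_space P by (rule prob(1))
  interpret Q: prob_space Q by (rule prob(2))
  have eq: "x * (\<integral>k. u (x + k) y \<partial>P) + y * (\<integral>k. u x (y + k) \<partial>Q) = (x + y) * u x y"
    if xy: "0 < x" "0 < y" for x y
  proof -
    have "sets \<mu> = sets borel" "sets \<nu> = sets borel" using \<mu> \<nu> by (auto simp: prob_on_def)
    then have set_int: "(LINT k:{0..\<beta>}|\<mu>. f k) = (\<integral>k. f k \<partial>P)"
      "(LINT k:{0..\<beta>}|\<nu>. f k) = (\<integral>k. f k \<partial>Q)" for f :: "real \<Rightarrow> real"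
      unfolding P_def Q_def set_lebesgue_integral_def
      by (intro integral_restrict_space[symmetric]; simp)+
    have "(x, y) \<in> SS" using xy by (simp add: SS_def)
    then have "x * (\<integral>k. u x y - u (x + k) y \<partial>P) + y * (\<integral>k. u x y - u x (y + k) \<partial>Q) = 0"
      using G unfolding is_G_def u_def set_int by auto
    then show ?thesis
      using i1[OF xy] i2[OF xy] by (simp add: P.prob_space Q.prob_space algebra_simps)
  qed
  show "superharmonic 0 (\<lambda>x y. measure (G (x, y)) {a..b})"
    unfolding u_def[symmetric] superharmonic_def using i1 i2 eq by auto
  show "superharmonic 0 (\<lambda>x y. - measure (G (x, y)) {a..b})"
    unfolding u_def[symmetric] superharmonic_def
  proof (intro allI impI conjI)
    fix x y :: real assume xy: "0 < x" "0 < y"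
    then show "x * (\<integral>k. - u (x + k) y \<partial>P) + y * (\<integral>k. - u x (y + k) \<partial>Q) \<le> (x + y) * - u x y"
      using eq[OF xy] by simp
  qed (use i1 i2 in auto)
qed

theorem theorem2p3:
  fixes \<beta> m0 :: real and \<mu> \<nu> :: "real measure" and \<phi> :: "real \<Rightarrow> real measure"
    and G :: "real \<times> real \<Rightarrow> real measure"
  assumes "0 < m0" "m0 \<le> \<beta>"
    and "prob_on 0 \<beta> \<mu>" "prob_on 0 \<beta> \<nu>"
    and "(\<integral>k. k \<partial>\<mu>) = (\<integral>k. k \<partial>\<nu>)" "(\<integral>k. k \<partial>\<mu>) \<ge> m0"
    and "\<forall>t\<in>{0..1}. prob_on 0 1 (\<phi> t)" "W_continuous_on {0..1} \<phi>"
    and "\<forall>s t. 0 \<le> s \<longrightarrow> s \<le> t \<longrightarrow> t \<le> 1 \<longrightarrow> st_le (\<phi> s) (\<phi> t)"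
    and "is_G \<beta> \<mu> \<nu> \<phi> G"
  shows "((\<exists>x0 y0. x0 > 0 \<and> y0 > 0 \<and> (\<forall>z\<in>{0..1}. measure (G (x0,y0)) {z} = 0))
            \<longrightarrow> (\<forall>z\<in>{0..1}. Phi \<phi> {z} = 0))
       \<and> ((\<forall>z\<in>{0..1}. Phi \<phi> {z} = 0)
            \<longrightarrow> (\<forall>x y. x > 0 \<longrightarrow> y > 0 \<longrightarrow> (\<forall>z\<in>{0..1}. measure (G (x,y)) {z} = 0)))"
proof -
  note G = \<open>is_G \<beta> \<mu> \<nu> \<phi> G\<close>
  define P Q where "P = restrict_space \<mu> {0..\<beta>}" and "Q = restrict_space \<nu> {0..\<beta>}"
  have urn: "urn \<beta> (\<integral>k. k \<partial>\<mu>) (restrict_space \<mu> {0..\<beta>}) (restrict_space \<nu> {0..\<beta>})"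
    using assms by (intro urn_restrict_space) auto
  interpret urn \<beta> "\<integral>k. k \<partial>\<mu>" P Q
    using urn by (simp add: P_def Q_def)
  interpret monotone_family \<phi>
    using assms by unfold_locales auto
  have harmonic: "superharmonic 0 (\<lambda>x y. measure (G (x, y)) {a..b})"
      "superharmonic 0 (\<lambda>x y. - measure (G (x, y)) {a..b})" for a b
    unfolding P_def Q_def using is_G_harmonic[OF assms(3,4) G urn] by auto
  have prob_G: "prob_on 0 1 (G (x, y))" if "0 < x" "0 < y" for x y
    using G that by (auto simp: is_G_def SS_def)
  have le_1: "measure (G (x, y)) A \<le> 1" if "0 < x" "0 < y" for x y A
    using prob_G[OF that] by (auto simp: prob_on_def intro: prob_space.prob_le_1)
  have prob_\<phi>: "prob_on 0 1 (\<phi> (x / (x + y)))" if "0 < x" "0 < y" for x y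
    using assms(7) that by auto
  have limit: "\<exists>R. \<forall>x>0. \<forall>y>0. R \<le> x + y \<longrightarrow> wasserstein1 (G (x, y)) (\<phi> (x / (x + y))) < e"
    if "0 < e" for e
  proof -
    obtain R where R: "\<And>x y. (x, y) \<in> SS \<Longrightarrow> R < x + y \<Longrightarrow> wasserstein1 (G (x, y)) (\<phi> (x / (x + y))) < e"
      using G \<open>0 < e\<close> unfolding is_G_def by blast
    show ?thesis
      by (intro exI[of _ "R + 1"] allI impI R) (auto simp: SS_def)
  qed
  \<comment> \<open>Contraposition of (1): a point charged by \<Phi> is charged at every interior
    state. Writing \<open>{z..z}\<close> lets the interval estimates apply.\<close>
  have "0 < measure (G (x0, y0)) {z..z}" if Phi: "Phi \<phi> {z} \<noteq> 0" and xy0: "0 < x0" "0 < y0" for z x0 y0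
  proof -
    obtain t0 \<rho> \<kappa> where *: "0 < \<rho>" "0 < \<kappa>" "0 < t0 - \<rho>" "t0 + \<rho> < 1"
      and \<kappa>: "\<And>t. \<bar>t - t0\<bar> \<le> \<rho> \<Longrightarrow> \<kappa> \<le> measure (\<phi> t) {z}"
      using mass_interval[OF Phi_nonzero_uncountable[OF Phi]] by auto
    have t0: "0 \<le> t0" "t0 \<le> 1" using * by auto
    \<comment> \<open>Wasserstein closeness controls only enlarged intervals. The lower bound does
      not depend on \<open>e\<close>, so it survives the passage to the point itself in
      \<open>low'\<close>.\<close>
    have low: "\<kappa> * (1 - ((x / (x + y) - t0)\<^sup>2 + 6 * \<beta> / (x + y)) / \<rho>\<^sup>2) \<le> measure (G (x, y)) {z - e..z + e}"
      if xy: "0 < x" "0 < y" "\<beta> \<le> x + y" and e: "0 < e" for x y e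
    proof (rule interval_lower_bound[OF harmonic(1) _ t0 *(1) less_imp_le[OF *(2)] _ xy])
      fix \<epsilon> :: real assume \<epsilon>: "0 < \<epsilon>"
      obtain R where R: "\<And>x y. 0 < x \<Longrightarrow> 0 < y \<Longrightarrow> R \<le> x + y \<Longrightarrow>
          wasserstein1 (G (x, y)) (\<phi> (x / (x + y))) < e * \<epsilon>"
        using limit[of "e * \<epsilon>"] e \<epsilon> by auto
      show "\<exists>R. \<forall>x>0. \<forall>y>0. R \<le> x + y \<longrightarrow> \<bar>x / (x + y) - t0\<bar> \<le> \<rho> \<longrightarrow>
          \<kappa> - \<epsilon> \<le> measure (G (x, y)) {z - e..z + e}"
      proof (intro exI allI impI)
        fix x y assume xy: "0 < x" "0 < y" "R \<le> x + y" "\<bar>x / (x + y) - t0\<bar> \<le> \<rho>"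
        have "measure (\<phi> (x / (x + y))) {z..z} \<le> measure (G (x, y)) {z - e..z + e} + \<epsilon>"
          using xy by (intro wasserstein_interval_le(2)[OF prob_G prob_\<phi> R e]) auto
        then show "\<kappa> - \<epsilon> \<le> measure (G (x, y)) {z - e..z + e}"
          using \<kappa>[OF xy(4)] by simp
      qed
    qed auto
    have low': "\<kappa> * (1 - ((x / (x + y) - t0)\<^sup>2 + 6 * \<beta> / (x + y)) / \<rho>\<^sup>2) \<le> measure (G (x, y)) {z..z}"
      if xy: "0 < x" "0 < y" "\<beta> \<le> x + y" for x y
    proof (rule ccontr)
      assume "\<not> ?thesis"
      then have "measure (G (x, y)) {z..z}
          < \<kappa> * (1 - ((x / (x + y) - t0)\<^sup>2 + 6 * \<beta> / (x + y)) / \<rho>\<^sup>2)" by simp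
      from interval_enlarge[OF prob_on_real_distribution[OF prob_G[OF xy(1,2)]] this]
      obtain e where "0 < e" "measure (G (x, y)) {z - e..z + e}
          < \<kappa> * (1 - ((x / (x + y) - t0)\<^sup>2 + 6 * \<beta> / (x + y)) / \<rho>\<^sup>2)"
        by blast
      with low[OF xy, of e] show False by simp
    qed
    show ?thesis
    proof (rule positivity_spreads[OF harmonic(1) _ t0 _ _ xy0])
      show "0 < \<rho> / 2" using *(1) by simp
      fix x y :: real
      assume xy: "0 < x" "0 < y" and s: "max \<beta> (12 * \<beta> / \<rho>\<^sup>2) \<le> x + y" and close: "\<bar>x / (x + y) - t0\<bar> \<le> \<rho> / 2"
      \<comment> \<open>In this cone the two terms are at most \<open>\<rho>\<^sup>2 / 4\<close> and
        \<open>\<rho>\<^sup>2 / 2\<close>, so at least a quarter of \<kappa> remains.\<close>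
      have "(x / (x + y) - t0)\<^sup>2 \<le> (\<rho> / 2)\<^sup>2"
        using close *(1) by (intro abs_le_square_iff[THEN iffD1]) auto
      moreover have "6 * \<beta> / (x + y) \<le> \<rho>\<^sup>2 / 2"
        using s xy *(1) by (simp add: field_simps)
      ultimately have "(x / (x + y) - t0)\<^sup>2 + 6 * \<beta> / (x + y) \<le> 3 / 4 * \<rho>\<^sup>2"
        by (simp add: power_divide)
      then have "((x / (x + y) - t0)\<^sup>2 + 6 * \<beta> / (x + y)) / \<rho>\<^sup>2 \<le> 3 / 4"
        using *(1) by (simp add: pos_divide_le_eq)
      then have "0 < \<kappa> * (1 - ((x / (x + y) - t0)\<^sup>2 + 6 * \<beta> / (x + y)) / \<rho>\<^sup>2)"
        by (intro mult_pos_pos *(2)) linarith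
      also have "\<dots> \<le> measure (G (x, y)) {z..z}"
        using low' xy s by simp
      finally show "0 < measure (G (x, y)) {z..z}" .
    qed auto
  qed
  moreover have "measure (G (x0, y0)) {z..z} \<le> 0" if Phi: "Phi \<phi> {z} = 0" and xy0: "0 < x0" "0 < y0" for z x0 y0
  proof (rule vanishing[OF harmonic(2) le_1 _ xy0])
    fix t0 :: real assume t0: "0 < t0" "t0 < 1"
    show "vanishes_around (\<lambda>x y. measure (G (x, y)) {z..z}) t0"
      unfolding vanishes_around_def
    proof (intro allI impI)
      fix \<epsilon> :: real assume \<epsilon>: "0 < \<epsilon>"
      then obtain \<rho> where \<rho>: "0 < \<rho>" "0 \<le> t0 - \<rho>" "t0 + \<rho> \<le> 1"
        and gap: "\<And>\<eta>. 0 < \<eta> \<Longrightarrow> \<eta> \<le> \<rho> \<Longrightarrow>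
          measure (\<phi> (t0 + \<eta>)) {..z} - measure (\<phi> (t0 + \<rho>)) {..<z} \<le> \<epsilon> / 3"
          "\<And>\<eta>. 0 < \<eta> \<Longrightarrow> \<eta> \<le> \<rho> \<Longrightarrow>
          measure (\<phi> (t0 - \<rho>)) {..z} - measure (\<phi> (t0 - \<eta>)) {..<z} \<le> \<epsilon> / 3"
        using one_sided_gaps[OF Phi t0, of "\<epsilon> / 3"] by auto
      \<comment> \<open>The three thirds of \<epsilon> pay for the gap between the half-line masses
        at \<open>a\<close> and \<open>b\<close>, for the enlargement of the point to an interval,
        and for the Wasserstein error. The claim is applied on each side of
        \<open>t0\<close>.\<close>
      have bound: "\<exists>R. \<forall>x>0. \<forall>y>0. R \<le> x + y \<longrightarrow> a \<le> x / (x + y) \<longrightarrow> x / (x + y) \<le> b \<longrightarrow>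
          measure (G (x, y)) {z..z} \<le> \<epsilon>"
        if ab: "0 \<le> a" "a \<le> b" "b \<le> 1" and g: "measure (\<phi> a) {..z} - measure (\<phi> b) {..<z} \<le> \<epsilon> / 3" for a b
      proof -
        obtain e where e: "0 < e" and mass: "\<And>t. a \<le> t \<Longrightarrow> t \<le> b \<Longrightarrow>
            measure (\<phi> t) {z - e..z + e} \<le> measure (\<phi> a) {..z} - measure (\<phi> b) {..<z} + \<epsilon> / 3"
          using interval_mass_bound[OF ab, of "\<epsilon> / 3"] \<epsilon> by auto
        obtain R where R: "\<And>x y. 0 < x \<Longrightarrow> 0 < y \<Longrightarrow> R \<le> x + y \<Longrightarrow>
            wasserstein1 (G (x, y)) (\<phi> (x / (x + y))) < e * (\<epsilon> / 3)"
          using limit[of "e * (\<epsilon> / 3)"] e \<epsilon> by auto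
        show ?thesis
        proof (intro exI allI impI)
          fix x y assume xy: "0 < x" "0 < y" "R \<le> x + y" "a \<le> x / (x + y)" "x / (x + y) \<le> b"
          have "measure (G (x, y)) {z..z} \<le> measure (\<phi> (x / (x + y))) {z - e..z + e} + \<epsilon> / 3"
            using xy by (intro wasserstein_interval_le(1)[OF prob_G prob_\<phi> R e]) auto
          then show "measure (G (x, y)) {z..z} \<le> \<epsilon>"
            using mass[OF xy(4,5)] g by simp
        qed
      qed
      show "\<exists>\<rho>>0. \<forall>\<eta>>0. \<exists>R. \<forall>x>0. \<forall>y>0. R \<le> x + y \<longrightarrow> \<eta> \<le> \<bar>x / (x + y) - t0\<bar> \<longrightarrow>
          \<bar>x / (x + y) - t0\<bar> \<le> \<rho> \<longrightarrow> measure (G (x, y)) {z..z} \<le> \<epsilon>"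
      proof (rule exI[of _ \<rho>], intro conjI \<rho>(1) allI impI)
        fix \<eta> :: real assume \<eta>: "0 < \<eta>"
        show "\<exists>R. \<forall>x>0. \<forall>y>0. R \<le> x + y \<longrightarrow> \<eta> \<le> \<bar>x / (x + y) - t0\<bar> \<longrightarrow>
            \<bar>x / (x + y) - t0\<bar> \<le> \<rho> \<longrightarrow> measure (G (x, y)) {z..z} \<le> \<epsilon>"
        proof (cases "\<eta> \<le> \<rho>")
          case True
          obtain R1 where R1: "\<And>x y. 0 < x \<Longrightarrow> 0 < y \<Longrightarrow> R1 \<le> x + y \<Longrightarrow> t0 + \<eta> \<le> x / (x + y) \<Longrightarrow>
              x / (x + y) \<le> t0 + \<rho> \<Longrightarrow> measure (G (x, y)) {z..z} \<le> \<epsilon>"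
            using bound[OF _ _ \<rho>(3) gap(1)[OF \<eta> True]] True \<eta> t0 by auto
          obtain R2 where R2: "\<And>x y. 0 < x \<Longrightarrow> 0 < y \<Longrightarrow> R2 \<le> x + y \<Longrightarrow> t0 - \<rho> \<le> x / (x + y) \<Longrightarrow>
              x / (x + y) \<le> t0 - \<eta> \<Longrightarrow> measure (G (x, y)) {z..z} \<le> \<epsilon>"
            using bound[OF \<rho>(2) _ _ gap(2)[OF \<eta> True]] True \<eta> t0 by auto
          show ?thesis
          proof (intro exI allI impI)
            fix x y assume xy: "0 < x" "0 < y" "max R1 R2 \<le> x + y" "\<eta> \<le> \<bar>x / (x + y) - t0\<bar>"
              "\<bar>x / (x + y) - t0\<bar> \<le> \<rho>"
            then consider "t0 + \<eta> \<le> x / (x + y)" "x / (x + y) \<le> t0 + \<rho>"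
              | "t0 - \<rho> \<le> x / (x + y)" "x / (x + y) \<le> t0 - \<eta>" by linarith
            then show "measure (G (x, y)) {z..z} \<le> \<epsilon>"
              using R1[OF xy(1,2)] R2[OF xy(1,2)] xy(3) by cases auto
          qed
        next
          case False
          then show ?thesis by (intro exI[of _ 0]) auto
        qed
      qed
    qed
  qed auto
  ultimately show ?thesis
    by (simp add: atLeastAtMost_singleton) (metis less_irrefl measure_nonneg antisym)
qed

end
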